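(* Let $\mu_1,\mu_2>0$, $\epsilon_1,\epsilon_2\in\{1,-1\}$, $c\in\mathbb{R}$, let $N,j\ge 0$ be integers, and put $\mu_{12}=\mu_1+\mu_2+j+\tfrac12$, $\epsilon_{12}=\epsilon_1\epsilon_2(-1)^j$. Then for real $\lambda_1,\lambda_2$ with $|\lambda_2|>|\lambda_1|>|c|$, $$K_j^{\epsilon_1\epsilon_2}(\lambda_2;\mu_2,\mu_1;c)\,P_N(\lambda_2;\mu_{12},c\epsilon_{12})\,J_j\Big(\frac{\epsilon_2\lambda_1}{\lambda_2};2\mu_2,2\mu_1,-\frac{c\epsilon_1\epsilon_2}{\lambda_2}\Big)$$ $$=\sum_{n_1+n_2=N+j}(-1)^{\phi(n_1,n_2,j)}\Big(\frac{\epsilon_2}{2}\Big)^{n_1}\sqrt{\frac{[n_2]_{\mu_2}!\,\rho_j(\mu_2,\mu_1,n_1+n_2)}{[n_1]_{\mu_1}!\,[n_1+n_2]_{\mu_2}!\,\nu_0(\mu_2,\mu_1,n_1+n_2)}}\;R_{n_1}(z_j;\mu_2,\mu_1,n_1+n_2)\,P_{n_1}(\lambda_1;\mu_1,c\epsilon_1)\,P_{n_2}(\lambda_2;\mu_2,\lambda_1\epsilon_2),$$ where the sum is over integers $n_1,n_2\ge0$ with $n_1+n_2=N+j$ and $$\phi(n_1,n_2,j)=\frac{n_1(n_1-1)}2+\frac{j(j+1)}2+n_1(n_1+n_2+1).$$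
   Context: Notation: $(a)_n=a(a+1)\cdots(a+n-1)$; $[n]_\mu=n+(1-(-1)^n)\mu$; $[n]_\mu!=[1]_\mu[2]_\mu\cdots[n]_\mu$, $[0]_\mu!=1$. Specialized Chihara polynomials $P_n(\lambda;\mu,\gamma)$: defined by $P_{-1}=0$, $P_0=1$ and $\lambda P_n=[n+1]_\mu^{1/2}P_{n+1}+\gamma(-1)^nP_n+[n]_\mu^{1/2}P_{n-1}$. Big $-1$ Jacobi polynomials $J_n(x;a,b,c)$: with $y=\frac{1-x^2}{1-c^2}$, for $n$ even $$J_n={}_2F_1\big(-\tfrac n2,\tfrac{n+a+b+2}2;\tfrac{a+1}2;y\big)+\tfrac{n(1-x)}{(1+c)(a+1)}\,{}_2F_1\big(1-\tfrac n2,\tfrac{n+a+b+2}2;\tfrac{a+3}2;y\big),$$ and for $n$ odd $$J_n={}_2F_1\big(-\tfrac{n-1}2,\tfrac{n+a+b+1}2;\tfrac{a+1}2;y\big)-\tfrac{(n+a+b+1)(1-x)}{(1+c)(a+1)}\,{}_2F_1\big(-\tfrac{n-1}2,\tfrac{n+a+b+3}2;\tfrac{a+3}2;y\big)$$ (for $n=0$ the second term is zero, $J_0=1$). Put $$h_n(a,b)=\frac{2\,\Gamma(\frac{n+b+1}2)\Gamma(\frac{n+a+3}2)(\frac n2)!}{(n+a+1)\Gamma(\frac{n+a+b+2}2)\big((\frac{a+1}2)_{n/2}\big)^2}\ (n\text{ even}),\qquad h_n(a,b)=\frac{(n+a+b+1)\Gamma(\frac{n+b+2}2)\Gamma(\frac{n+a+2}2)(\frac{n-1}2)!}{2\,\Gamma(\frac{n+a+b+3}2)\big((\frac{a+1}2)_{(n+1)/2}\big)^2}\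 (n\text{ odd}).$$ For $\alpha,\beta>0$, $\sigma\in\{1,-1\}$, $|\lambda|>|c|$ put $$K_j^{\sigma}(\lambda;\beta,\alpha;c)=\sqrt{\Big(\frac{\lambda^2-c^2}2\Big)^j\Big(\frac{\lambda-c\sigma}{\lambda-(-1)^jc\sigma}\Big)\frac{\Gamma(\alpha+\frac12)\Gamma(\beta+\frac12)}{\Gamma(\alpha+\beta+j+1)\,h_j(2\beta,2\alpha)}}.$$ Dual $-1$ Hahn polynomials $R_n(x;\eta,\xi,M)$, $0\le n\le M$: monic polynomials with $R_{-1}=0$, $R_0=1$, $$xR_n=R_{n+1}+\big((-1)^{n+1}(2\xi+(-1)^M2\eta)-1\big)R_n+4[n]_\xi[M-n+1]_\eta R_{n-1}.$$ They are evaluated at $z_s=(-1)^{s+M+1}(2s+2\eta+2\xi+1)$ (with $\eta,\xi,M$ the parameters of the polynomial being evaluated). For $0\le s\le M$ set $\rho_s(\eta,\xi,M)=\varpi_{M-s}(\eta,\xi,M)$ if $M$ is even and $\rho_s=\varpi_s$ if $M$ is odd, where: for $M$ even, $$\varpi_s=(-1)^{\frac s2}\frac{(-\frac M2)_{\frac s2}(-\frac M2-\eta+\frac12)_{\frac s2}(-M-\eta-\xi)_{\frac s2}}{(\frac s2)!\,(-\frac M2-\xi+\frac12)_{\frac s2}(-\frac M2-\eta-\xi)_{\frac s2}}\ (s\text{ even}),\quad \varpi_s=(-1)^{\frac{s-1}2}\frac{(-\frac M2)_{\frac{s+1}2}(-\frac M2-\eta+\frac12)_{\frac{s-1}2}(-M-\eta-\xi)_{\frac{s-1}2}}{(\frac{s-1}2)!\,(-\frac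 M2-\xi+\frac12)_{\frac{s-1}2}(-\frac M2-\eta-\xi)_{\frac{s+1}2}}\ (s\text{ odd}),$$ $$\nu_0(\eta,\xi,M)=\frac{(-M-\eta-\xi)_{M/2}}{(\frac{-M-2\xi+1}2)_{M/2}};$$ for $M$ odd, $$\varpi_s=(-1)^{\frac s2}\frac{(\frac{1-M}2)_{\frac s2}(\xi+\frac12)_{\frac s2}(\eta+\xi+1)_{\frac s2}}{(\frac s2)!\,(\eta+\frac12)_{\frac s2}(\frac{M+3}2+\eta+\xi)_{\frac s2}}\ (s\text{ even}),\quad \varpi_s=(-1)^{\frac{s-1}2}\frac{(\frac{1-M}2)_{\frac{s-1}2}(\xi+\frac12)_{\frac{s+1}2}(\eta+\xi+1)_{\frac{s-1}2}}{(\frac{s-1}2)!\,(\eta+\frac12)_{\frac{s+1}2}(\frac{M+3}2+\eta+\xi)_{\frac{s-1}2}}\ (s\text{ odd}),$$ $$\nu_0(\eta,\xi,M)=\frac{(\eta+\xi+1)_{(M+1)/2}}{(\eta+\frac12)_{(M+1)/2}}.$$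
   Formalization: The left side carries an extra factor sgn(λ_2)^j: with the nonnegative square root in K_j the printed identity is off by a sign when λ_2<0 and j is odd (e.g. N=0, j=1, c=0, μ_1=μ_2, ε_1=ε_2=1); in all other cases the factor is 1. *)

theory Defs
  imports "HOL-Analysis.Analysis"
begin

text \<open>Throughout, polynomials enter only through their values at real points, so the
  orthogonal polynomials are real-valued functions of the degree and the argument.\<close>

definition mu_num :: "nat \<Rightarrow> real \<Rightarrow> real" where
  "mu_num n \<mu> = real n + (1 - (-1) ^ n) * \<mu>"

definition mu_fact :: "nat \<Rightarrow> real \<Rightarrow> real" where
  "mu_fact n \<mu> = (\<Prod>k=1..n. mu_num k \<mu>)"

text \<open>Specialized Chihara polynomials: the three-term recurrence solved for its highest
  term. \<open>chihara_recurrence\<close> below restates it in the usual form; for \<open>n = 0\<close> the term of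
  degree \<open>-1\<close> is absent.\<close>

fun chihara :: "nat \<Rightarrow> real \<Rightarrow> real \<Rightarrow> real \<Rightarrow> real" where
  "chihara 0 x \<mu> \<gamma> = 1"
| "chihara (Suc 0) x \<mu> \<gamma> = (x - \<gamma>) / sqrt (mu_num 1 \<mu>)"
| "chihara (Suc (Suc n)) x \<mu> \<gamma> =
     ((x - \<gamma> * (-1) ^ Suc n) * chihara (Suc n) x \<mu> \<gamma>
       - sqrt (mu_num (Suc n) \<mu>) * chihara n x \<mu> \<gamma>) / sqrt (mu_num (Suc (Suc n)) \<mu>)"

lemma mu_num_pos: "\<mu> > 0 \<Longrightarrow> n > 0 \<Longrightarrow> mu_num n \<mu> > 0"
  by (cases "even n") (auto simp: mu_num_def)

lemma chihara_recurrence: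
  assumes "\<mu> > 0"
  shows "x * chihara n x \<mu> \<gamma> =
    sqrt (mu_num (n + 1) \<mu>) * chihara (n + 1) x \<mu> \<gamma> + \<gamma> * (-1) ^ n * chihara n x \<mu> \<gamma>
      + (if n = 0 then 0 else sqrt (mu_num n \<mu>) * chihara (n - 1) x \<mu> \<gamma>)"
proof -
  have "sqrt (mu_num (Suc n) \<mu>) \<noteq> 0"
    using mu_num_pos[OF assms, of "Suc n"] by simp
  then show ?thesis
    by (cases n) (simp_all add: field_simps)
qed

definition hyp2F1 :: "real \<Rightarrow> real \<Rightarrow> real \<Rightarrow> real \<Rightarrow> real" where
  "hyp2F1 a b c x = eval_fps (fps_hypergeo [a, b] [c] 1) x"

lemma hyp2F1_eq_suminf:
  "hyp2F1 a b c x =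
    (\<Sum>k. pochhammer a k * pochhammer b k / (pochhammer c k * fact k) * x ^ k)"
  by (simp add: hyp2F1_def eval_fps_def)

text \<open>Big \<open>-1\<close> Jacobi polynomials. All hypergeometric series that occur terminate, except the
  second one for \<open>n = 0\<close>, which is multiplied by \<open>0\<close>.\<close>

definition big_jacobi :: "nat \<Rightarrow> real \<Rightarrow> real \<Rightarrow> real \<Rightarrow> real \<Rightarrow> real" where
  "big_jacobi n x a b c =
    (let y = (1 - x\<^sup>2) / (1 - c\<^sup>2) in
     if even n then
       hyp2F1 (- real n / 2) ((real n + a + b + 2) / 2) ((a + 1) / 2) y
       + real n * (1 - x) / ((1 + c) * (a + 1))
         * hyp2F1 (1 - real n / 2) ((real n + a + b + 2) / 2) ((a + 3) / 2) y
     else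
       hyp2F1 (- (real n - 1) / 2) ((real n + a + b + 1) / 2) ((a + 1) / 2) y
       - (real n + a + b + 1) * (1 - x) / ((1 + c) * (a + 1))
         * hyp2F1 (- (real n - 1) / 2) ((real n + a + b + 3) / 2) ((a + 3) / 2) y)"

lemma big_jacobi_0: "big_jacobi 0 x a b c = 1"
proof -
  have "(\<Sum>k. pochhammer 0 k * pochhammer p k / (pochhammer q k * fact k) * y ^ k) = (1::real)"
    for p q y :: real
    by (subst suminf_finite[where N = "{0}"]) (auto simp: pochhammer_0_left)
  then show ?thesis
    by (simp add: big_jacobi_def hyp2F1_eq_suminf)
qed

definition jacobi_h :: "nat \<Rightarrow> real \<Rightarrow> real \<Rightarrow> real" where
  "jacobi_h n a b =
    (if even n then
       2 * Gamma ((real n + b + 1) / 2) * Gamma ((real n + a + 3) / 2) * fact (n div 2)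
       / ((real n + a + 1) * Gamma ((real n + a + b + 2) / 2)
          * (pochhammer ((a + 1) / 2) (n div 2))\<^sup>2)
     else
       (real n + a + b + 1) * Gamma ((real n + b + 2) / 2) * Gamma ((real n + a + 2) / 2)
         * fact ((n - 1) div 2)
       / (2 * Gamma ((real n + a + b + 3) / 2)
          * (pochhammer ((a + 1) / 2) ((n + 1) div 2))\<^sup>2))"

text \<open>\<open>sqrt\<close> is the nonnegative root. The addition formula for Chihara polynomials needs the
  root that behaves like \<open>x ^ j\<close> in the variable \<open>x\<close>, that is \<open>sgn x ^ j * jacobi_K j \<sigma> x \<beta> \<alpha> c\<close>;
  the two agree unless \<open>x < 0\<close> and \<open>j\<close> is odd, where the formula with the nonnegative root
  is off by a sign. The factor \<open>sgn x ^ j\<close> is therefore written explicitly in the theorem.\<close>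

definition jacobi_K :: "nat \<Rightarrow> real \<Rightarrow> real \<Rightarrow> real \<Rightarrow> real \<Rightarrow> real \<Rightarrow> real" where
  "jacobi_K j \<sigma> x \<beta> \<alpha> c =
    sqrt (((x\<^sup>2 - c\<^sup>2) / 2) ^ j * ((x - c * \<sigma>) / (x - (-1) ^ j * c * \<sigma>))
      * (Gamma (\<alpha> + 1/2) * Gamma (\<beta> + 1/2)
         / (Gamma (\<alpha> + \<beta> + real j + 1) * jacobi_h j (2 * \<beta>) (2 * \<alpha>))))"

text \<open>Dual \<open>-1\<close> Hahn polynomials; only degrees \<open>n \<le> M\<close> are meaningful, and there the
  natural-number subtraction \<open>M + 1 - n\<close> is exact.\<close>

definition hahn_b :: "nat \<Rightarrow> real \<Rightarrow> real \<Rightarrow> nat \<Rightarrow> real" where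
  "hahn_b n \<eta> \<xi> M = (-1) ^ (n + 1) * (2 * \<xi> + (-1) ^ M * 2 * \<eta>) - 1"

definition hahn_u :: "nat \<Rightarrow> real \<Rightarrow> real \<Rightarrow> nat \<Rightarrow> real" where
  "hahn_u n \<eta> \<xi> M = 4 * mu_num n \<xi> * mu_num (M + 1 - n) \<eta>"

fun dual_hahn :: "nat \<Rightarrow> real \<Rightarrow> real \<Rightarrow> real \<Rightarrow> nat \<Rightarrow> real" where
  "dual_hahn 0 x \<eta> \<xi> M = 1"
| "dual_hahn (Suc 0) x \<eta> \<xi> M = x - hahn_b 0 \<eta> \<xi> M"
| "dual_hahn (Suc (Suc n)) x \<eta> \<xi> M =
     (x - hahn_b (Suc n) \<eta> \<xi> M) * dual_hahn (Suc n) x \<eta> \<xi> M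
       - hahn_u (Suc n) \<eta> \<xi> M * dual_hahn n x \<eta> \<xi> M"

lemma dual_hahn_recurrence:
  "x * dual_hahn n x \<eta> \<xi> M =
    dual_hahn (n + 1) x \<eta> \<xi> M + hahn_b n \<eta> \<xi> M * dual_hahn n x \<eta> \<xi> M
      + (if n = 0 then 0 else hahn_u n \<eta> \<xi> M * dual_hahn (n - 1) x \<eta> \<xi> M)"
  by (cases n) (simp_all add: algebra_simps)

definition hahn_z :: "nat \<Rightarrow> real \<Rightarrow> real \<Rightarrow> nat \<Rightarrow> real" where
  "hahn_z s \<eta> \<xi> M = (-1) ^ (s + M + 1) * (2 * real s + 2 * \<eta> + 2 * \<xi> + 1)"

definition hahn_varpi :: "nat \<Rightarrow> real \<Rightarrow> real \<Rightarrow> nat \<Rightarrow> real" where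
  "hahn_varpi s \<eta> \<xi> M =
    (if even M then
       if even s then
         (-1) ^ (s div 2)
         * (pochhammer (- real M / 2) (s div 2)
            * pochhammer (- real M / 2 - \<eta> + 1/2) (s div 2)
            * pochhammer (- real M - \<eta> - \<xi>) (s div 2))
         / (fact (s div 2)
            * pochhammer (- real M / 2 - \<xi> + 1/2) (s div 2)
            * pochhammer (- real M / 2 - \<eta> - \<xi>) (s div 2))
       else
         (-1) ^ ((s - 1) div 2)
         * (pochhammer (- real M / 2) ((s + 1) div 2)
            * pochhammer (- real M / 2 - \<eta> + 1/2) ((s - 1) div 2)
            * pochhammer (- real M - \<eta> - \<xi>) ((s - 1) div 2))
         / (fact ((s - 1) div 2)
            * pochhammer (- real M / 2 - \<xi> + 1/2) ((s - 1) div 2)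
            * pochhammer (- real M / 2 - \<eta> - \<xi>) ((s + 1) div 2))
     else
       if even s then
         (-1) ^ (s div 2)
         * (pochhammer ((1 - real M) / 2) (s div 2)
            * pochhammer (\<xi> + 1/2) (s div 2)
            * pochhammer (\<eta> + \<xi> + 1) (s div 2))
         / (fact (s div 2)
            * pochhammer (\<eta> + 1/2) (s div 2)
            * pochhammer ((real M + 3) / 2 + \<eta> + \<xi>) (s div 2))
       else
         (-1) ^ ((s - 1) div 2)
         * (pochhammer ((1 - real M) / 2) ((s - 1) div 2)
            * pochhammer (\<xi> + 1/2) ((s + 1) div 2)
            * pochhammer (\<eta> + \<xi> + 1) ((s - 1) div 2))
         / (fact ((s - 1) div 2)
            * pochhammer (\<eta> + 1/2) ((s + 1) div 2)
            * pochhammer ((real M + 3) / 2 + \<eta> + \<xi>) ((s - 1) div 2)))"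

definition hahn_nu0 :: "real \<Rightarrow> real \<Rightarrow> nat \<Rightarrow> real" where
  "hahn_nu0 \<eta> \<xi> M =
    (if even M then
       pochhammer (- real M - \<eta> - \<xi>) (M div 2)
       / pochhammer ((- real M - 2 * \<xi> + 1) / 2) (M div 2)
     else
       pochhammer (\<eta> + \<xi> + 1) ((M + 1) div 2)
       / pochhammer (\<eta> + 1/2) ((M + 1) div 2))"

definition hahn_rho :: "nat \<Rightarrow> real \<Rightarrow> real \<Rightarrow> nat \<Rightarrow> real" where
  "hahn_rho s \<eta> \<xi> M =
    (if even M then hahn_varpi (M - s) \<eta> \<xi> M else hahn_varpi s \<eta> \<xi> M)"

definition cg_phase :: "nat \<Rightarrow> nat \<Rightarrow> nat \<Rightarrow> nat" where
  "cg_phase n1 n2 j = n1 * (n1 - 1) div 2 + j * (j + 1) div 2 + n1 * (n1 + n2 + 1)"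

end

theory Submission
  imports Defs
begin

text \<open>The monic Chihara polynomials span modules of the algebra \<open>sl\<^sub>-\<^sub>1(2)\<close>, generated by a raising and
  a lowering operator whose anticommutator is diagonal, and multiplication by \<open>\<lambda>\<^sub>2\<close> acts on the
  products \<open>P\<^bsub>n1\<^esub>(\<lambda>\<^sub>1) P\<^bsub>n2\<^esub>(\<lambda>\<^sub>2)\<close> as raising + lowering + diagonal on the tensor product of two such
  modules. The powers of the raising operator applied to the lowest weight vector of degree \<open>j\<close> span
  an irreducible submodule with parameter \<open>\<mu>\<^sub>1 + \<mu>\<^sub>2 + j + 1/2\<close>; hence the pairing of the \<open>N\<close>-th of them
  with the products is \<open>P\<^sub>N(\<lambda>\<^sub>2)\<close> times the pairing for \<open>N = 0\<close>. These vectors are eigenvectors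
  of raising after lowering, and their coordinates therefore satisfy the three-term recurrence
  of the dual \<open>-1\<close> Hahn polynomials. For \<open>N = 0\<close> the coordinates are explicit. The Chihara polynomials
  are Laguerre polynomials with generating function
  \<open>e\<^bsup>-t/2\<^esup> \<^sub>0F\<^sub>1(a; ut/4)\<close>, the alternating signs of the lowest weight vector cancel the exponentials
  in the convolution, and what remains is a Jacobi polynomial in two homogeneous variables.\<close>

section \<open>Monic Chihara polynomials\<close>

lemma mu_num_0 [simp]: "mu_num 0 \<mu> = 0"
  by (simp add: mu_num_def)

text \<open>The alternating parts of consecutive numbers cancel and leave an affine function of
  \<open>n\<close>. This makes the anticommutator of raising and lowering diagonal.\<close>

lemma mu_num_Suc_add: "mu_num (Suc n) \<mu> + mu_num n \<mu> = 2 * real n + 1 + 2 * \<mu>"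
  by (simp add: mu_num_def algebra_simps)

lemma mu_fact_0 [simp]: "mu_fact 0 \<mu> = 1"
  by (simp add: mu_fact_def)

lemma mu_fact_Suc: "mu_fact (Suc n) \<mu> = mu_num (Suc n) \<mu> * mu_fact n \<mu>"
  by (simp add: mu_fact_def mult.commute)

lemma mu_fact_pos: "\<mu> > 0 \<Longrightarrow> mu_fact n \<mu> > 0"
  by (induction n) (auto simp: mu_fact_Suc intro!: mult_pos_pos mu_num_pos)

text \<open>Each pair of consecutive factors, an odd one followed by an even one, contributes
  \<open>4 * (k + 1) * (\<mu> + 1/2 + k)\<close>.\<close>

lemma mu_fact_even:
  "mu_fact (2 * m) \<mu> = 4 ^ m * fact m * pochhammer (\<mu> + 1/2) m"
  by (induction m)
    (simp_all add: mu_fact_Suc mu_num_def pochhammer_Suc field_simps)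

lemma mu_fact_odd:
  "mu_fact (Suc (2 * m)) \<mu> = 2 * 4 ^ m * fact m * pochhammer (\<mu> + 1/2) (Suc m)"
  unfolding mu_fact_Suc mu_fact_even by (simp add: mu_num_def pochhammer_Suc algebra_simps)

definition monic_chihara :: "nat \<Rightarrow> real \<Rightarrow> real \<Rightarrow> real \<Rightarrow> real" where
  "monic_chihara n x \<mu> \<gamma> = sqrt (mu_fact n \<mu>) * chihara n x \<mu> \<gamma>"

lemma monic_chihara_0 [simp]: "monic_chihara 0 x \<mu> \<gamma> = 1"
  by (simp add: monic_chihara_def)

text \<open>Multiplying by \<open>sqrt (mu_fact n \<mu>)\<close> clears the square roots. At
  \<open>n = 0\<close> the truncated index \<open>n - 1\<close> is harmless, since
  \<open>mu_num 0 \<mu> = 0\<close>.\<close>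

lemma monic_chihara_recurrence:
  assumes "\<mu> > 0"
  shows "x * monic_chihara n x \<mu> \<gamma> = monic_chihara (Suc n) x \<mu> \<gamma>
    + \<gamma> * (-1) ^ n * monic_chihara n x \<mu> \<gamma> + mu_num n \<mu> * monic_chihara (n - 1) x \<mu> \<gamma>"
proof (cases n)
  case 0
  then show ?thesis
    using mu_num_pos[OF assms, of 1] by (simp add: monic_chihara_def mu_fact_Suc)
next
  case (Suc k)
  have pos: "mu_num n \<mu> > 0"
    using mu_num_pos[OF assms] Suc by simp
  have "x * monic_chihara n x \<mu> \<gamma> = sqrt (mu_fact n \<mu>) * (x * chihara n x \<mu> \<gamma>)"
    by (simp add: monic_chihara_def)
  also have "\<dots> = sqrt (mu_fact n \<mu>) * (sqrt (mu_num (n + 1) \<mu>) * chihara (n + 1) x \<mu> \<gamma>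
      + \<gamma> * (-1) ^ n * chihara n x \<mu> \<gamma> + sqrt (mu_num n \<mu>) * chihara (n - 1) x \<mu> \<gamma>)"
    by (subst chihara_recurrence[OF assms]) (simp add: Suc)
  also have "\<dots> = monic_chihara (Suc n) x \<mu> \<gamma> + \<gamma> * (-1) ^ n * monic_chihara n x \<mu> \<gamma>
      + sqrt (mu_fact n \<mu>) * sqrt (mu_num n \<mu>) * chihara (n - 1) x \<mu> \<gamma>"
    by (simp add: monic_chihara_def mu_fact_Suc real_sqrt_mult algebra_simps)
  also have "sqrt (mu_fact n \<mu>) * sqrt (mu_num n \<mu>) = mu_num n \<mu> * sqrt (mu_fact (n - 1) \<mu>)"
    using pos by (simp add: Suc mu_fact_Suc real_sqrt_mult)
  finally show ?thesis
    by (simp add: monic_chihara_def)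
qed

section \<open>The tensor product representation\<close>

text \<open>A vector is given by its coordinates \<open>v m n\<close>. With \<open>R\<close> the operator \<open>\<epsilon> (-1)\<^sup>n\<close> on the second
  factor, \<open>raise\<close> is \<open>A\<^sub>+ \<otimes> R + 1 \<otimes> A\<^sub>+\<close> and \<open>lower\<close> is \<open>A\<^sub>- \<otimes> R + 1 \<otimes> A\<^sub>-\<close>.\<close>

definition raise :: "real \<Rightarrow> (nat \<Rightarrow> nat \<Rightarrow> real) \<Rightarrow> nat \<Rightarrow> nat \<Rightarrow> real" where
  "raise \<epsilon> v m n = (if m = 0 then 0 else \<epsilon> * (-1) ^ n * v (m - 1) n)
    + (if n = 0 then 0 else v m (n - 1))"

definition lower :: "real \<Rightarrow> real \<Rightarrow> real \<Rightarrow> (nat \<Rightarrow> nat \<Rightarrow> real) \<Rightarrow> nat \<Rightarrow> nat \<Rightarrow> real" where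
  "lower \<mu> \<nu> \<epsilon> v m n = \<epsilon> * (-1) ^ n * mu_num (Suc m) \<mu> * v (Suc m) n
    + mu_num (Suc n) \<nu> * v m (Suc n)"

text \<open>In the mixed terms an operator of the second factor shifts \<open>n\<close> by one and
  flips \<open>(-1) ^ n\<close>, so they cancel. The unmixed terms combine, with \<epsilon> squaring
  to one, to the sums in \<open>mu_num_Suc_add\<close>.\<close>

lemma raise_lower_anticommutator:
  assumes "\<epsilon> \<in> {1, -1}"
  shows "lower \<mu> \<nu> \<epsilon> (raise \<epsilon> v) m n + raise \<epsilon> (lower \<mu> \<nu> \<epsilon> v) m n
    = 2 * (real m + real n + 1 + \<mu> + \<nu>) * v m n"
proof -
  have e: "\<epsilon> * (\<epsilon> * x) = x" "\<epsilon> * \<epsilon> = 1" for x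
    using assms by auto
  have s1: "2 * (real m + real n + 1 + \<mu> + \<nu>) * v m n
     = (mu_num (Suc m) \<mu> + mu_num m \<mu>) * v m n + (mu_num (Suc n) \<nu> + mu_num n \<nu>) * v m n"
    unfolding mu_num_Suc_add by (simp add: algebra_simps)
  show ?thesis
    unfolding s1
    by (cases m; cases n) (simp_all add: raise_def lower_def algebra_simps e)
qed

section \<open>Pairing vectors with products of polynomials\<close>

definition pairing :: "(nat \<Rightarrow> real) \<Rightarrow> (nat \<Rightarrow> real) \<Rightarrow> nat \<Rightarrow> (nat \<Rightarrow> nat \<Rightarrow> real) \<Rightarrow> real" where
  "pairing f g M v = (\<Sum>n\<le>M. v n (M - n) * f n * g (M - n))"

lemma pairing_cmult: "(\<And>m n. v m n = k * w m n) \<Longrightarrow> pairing f g M v = k * pairing f g M w"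
  by (simp add: pairing_def sum_distrib_left mult_ac)

text \<open>The transpose of raising: each summand of \<open>raise\<close> is reindexed so that the
  shift falls on \<open>f\<close> or on \<open>g\<close>.\<close>

lemma pairing_raise:
  "pairing f g (Suc M) (raise \<epsilon> v)
    = (\<Sum>n\<le>M. v n (M - n) * (\<epsilon> * (-1) ^ (M - n) * f (Suc n) * g (M - n) + f n * g (Suc (M - n))))"
proof -
  have "pairing f g (Suc M) (raise \<epsilon> v)
    = (\<Sum>n\<le>Suc M. (if n = 0 then 0 else \<epsilon> * (-1) ^ (Suc M - n) * v (n - 1) (Suc M - n)) * f n * g (Suc M - n))
    + (\<Sum>n\<le>Suc M. (if Suc M - n = 0 then 0 else v n (M - n)) * f n * g (Suc M - n))"
    unfolding pairing_def raise_def sum.distrib[symmetric]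
    by (intro sum.cong) (auto simp: algebra_simps)
  also have "(\<Sum>n\<le>Suc M. (if n = 0 then 0 else \<epsilon> * (-1) ^ (Suc M - n) * v (n - 1) (Suc M - n)) * f n * g (Suc M - n))
    = (\<Sum>n\<le>M. \<epsilon> * (-1) ^ (M - n) * v n (M - n) * f (Suc n) * g (M - n))"
    by (subst sum.atMost_Suc_shift) simp
  also have "(\<Sum>n\<le>Suc M. (if Suc M - n = 0 then 0 else v n (M - n)) * f n * g (Suc M - n))
    = (\<Sum>n\<le>M. v n (M - n) * f n * g (Suc (M - n)))"
    by (subst sum.atMost_Suc) (auto intro!: sum.cong simp: Suc_diff_le)
  finally show ?thesis
    by (simp add: sum.distrib[symmetric] algebra_simps)
qed

text \<open>The transpose of lowering. The boundary terms at \<open>n = 0\<close> and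
  \<open>n = Suc M\<close> enter with a factor \<open>mu_num 0\<close>, so the truncated indices
  there do no harm.\<close>

lemma pairing_lower:
  "pairing f g M (lower \<mu> \<nu> \<epsilon> v)
    = (\<Sum>n\<le>Suc M. v n (Suc M - n) * (\<epsilon> * (-1) ^ (Suc M - n) * mu_num n \<mu> * f (n - 1) * g (Suc M - n)
        + mu_num (Suc M - n) \<nu> * f n * g (Suc M - n - 1)))"
proof -
  have 1: "(\<Sum>n\<le>Suc M. \<epsilon> * (-1) ^ (Suc M - n) * mu_num n \<mu> * v n (Suc M - n) * f (n - 1) * g (Suc M - n))
    = (\<Sum>n\<le>M. \<epsilon> * (-1) ^ (M - n) * mu_num (Suc n) \<mu> * v (Suc n) (M - n) * f n * g (M - n))"
    by (subst sum.atMost_Suc_shift) simp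
  have 2: "(\<Sum>n\<le>Suc M. mu_num (Suc M - n) \<nu> * v n (Suc M - n) * f n * g (Suc M - n - 1))
    = (\<Sum>n\<le>M. mu_num (Suc (M - n)) \<nu> * v n (Suc (M - n)) * f n * g (M - n))"
    by (subst sum.atMost_Suc) (auto intro!: sum.cong simp: Suc_diff_le)
  have "(\<Sum>n\<le>Suc M. v n (Suc M - n) * (\<epsilon> * (-1) ^ (Suc M - n) * mu_num n \<mu> * f (n - 1) * g (Suc M - n)
        + mu_num (Suc M - n) \<nu> * f n * g (Suc M - n - 1)))
    = (\<Sum>n\<le>Suc M. \<epsilon> * (-1) ^ (Suc M - n) * mu_num n \<mu> * v n (Suc M - n) * f (n - 1) * g (Suc M - n))
    + (\<Sum>n\<le>Suc M. mu_num (Suc M - n) \<nu> * v n (Suc M - n) * f n * g (Suc M - n - 1))"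
    unfolding sum.distrib[symmetric] by (intro sum.cong refl) (simp add: algebra_simps)
  then show ?thesis
    unfolding 1 2 pairing_def lower_def sum.distrib[symmetric]
    by (simp add: algebra_simps)
qed

text \<open>The diagonal coefficient \<open>x * \<epsilon> * (-1) ^ (M - n)\<close> in the
  recurrence of \<open>g\<close> contains \<open>x\<close>, which the recurrence of \<open>f\<close>
  absorbs. The diagonal sign that remains is \<open>(-1) ^ n * (-1) ^ (M - n)\<close>, a function of
  the grade \<open>M\<close> alone; the other terms are the transposes of raising and
  lowering.\<close>

lemma pairing_recurrence:
  fixes \<mu> \<nu> \<delta> \<epsilon> c x y :: real
  defines "f \<equiv> \<lambda>n. monic_chihara n x \<mu> (c * \<delta>)" and "g \<equiv> \<lambda>n. monic_chihara n y \<nu> (x * \<epsilon>)"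
  assumes "\<mu> > 0" "\<nu> > 0"
  shows "y * pairing f g M v = pairing f g (Suc M) (raise \<epsilon> v)
    + c * (\<delta> * \<epsilon> * (-1) ^ M) * pairing f g M v
    + (if M = 0 then 0 else pairing f g (M - 1) (lower \<mu> \<nu> \<epsilon> v))"
proof -
  define L where "L n = v n (M - n) * (\<epsilon> * (-1) ^ (M - n) * mu_num n \<mu> * f (n - 1) * g (M - n)
        + mu_num (M - n) \<nu> * f n * g (M - n - 1))" for n
  \<comment> \<open>For \<open>M = 0\<close> both factors \<open>mu_num 0\<close> vanish, so the sum
    of \<open>L\<close> agrees with the absent lowering term.\<close>
  have low: "(if M = 0 then 0 else pairing f g (M - 1) (lower \<mu> \<nu> \<epsilon> v)) = (\<Sum>n\<le>M. L n)"
    by (cases M) (simp_all add: L_def pairing_lower)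
  have summand: "y * (v n (M - n) * f n * g (M - n))
    = v n (M - n) * (\<epsilon> * (-1) ^ (M - n) * f (Suc n) * g (M - n) + f n * g (Suc (M - n)))
      + c * (\<delta> * \<epsilon> * (-1) ^ M) * (v n (M - n) * f n * g (M - n)) + L n"
    if n: "n \<le> M" for n
  proof -
    have fx: "x * f n = f (Suc n) + c * \<delta> * (-1) ^ n * f n + mu_num n \<mu> * f (n - 1)"
      unfolding f_def by (rule monic_chihara_recurrence) fact
    have gy: "y * g (M - n) = g (Suc (M - n)) + x * \<epsilon> * (-1) ^ (M - n) * g (M - n)
        + mu_num (M - n) \<nu> * g (M - n - 1)"
      unfolding g_def by (rule monic_chihara_recurrence) fact
    have sgn: "(-1 :: real) ^ M = (-1) ^ n * (-1) ^ (M - n)"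
      using n by (simp flip: power_add)
    have "y * (v n (M - n) * f n * g (M - n)) = v n (M - n) * f n * (y * g (M - n))"
      by simp
    also have "\<dots> = v n (M - n) * (f n * g (Suc (M - n)) + \<epsilon> * (-1) ^ (M - n) * (x * f n) * g (M - n)
        + mu_num (M - n) \<nu> * f n * g (M - n - 1))"
      unfolding gy by (simp add: algebra_simps)
    finally show ?thesis
      unfolding fx L_def sgn by (simp add: algebra_simps)
  qed
  show ?thesis
    unfolding low pairing_raise unfolding pairing_def sum_distrib_left sum.distrib[symmetric]
    by (intro sum.cong refl summand) simp
qed

text \<open>Spans the kernel of \<open>lower\<close> in grade \<open>j\<close>: with the factorials
  split off, the step from \<open>m\<close> to \<open>m + 1\<close> multiplies by
  \<open>\<epsilon> * (-1) ^ (j - m)\<close>, and the exponent has the parity of the sum of these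
  \<open>j - m\<close>.\<close>

definition lowest :: "real \<Rightarrow> real \<Rightarrow> real \<Rightarrow> nat \<Rightarrow> nat \<Rightarrow> nat \<Rightarrow> real" where
  "lowest \<mu> \<nu> \<epsilon> j m n = (if m + n = j
     then \<epsilon> ^ m * (-1) ^ (j * m + m * (m - 1) div 2) / (mu_fact m \<mu> * mu_fact n \<nu>) else 0)"

lemma Suc_choose_two_div: "Suc m * m div 2 = m * (m - 1) div 2 + m"
proof (cases m)
  case (Suc k)
  have "Suc m * m = m * (m - 1) + m * 2"
    using Suc by simp
  then show ?thesis
    by (simp only: div_mult_self1)
qed simp

lemma raise_zero: "(\<And>m n. v m n = 0) \<Longrightarrow> raise \<epsilon> v m n = 0"
  by (simp add: raise_def)

lemma raise_cmult: "(\<And>m n. v m n = k * w m n) \<Longrightarrow> raise \<epsilon> v m n = k * raise \<epsilon> w m n"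
  by (simp add: raise_def algebra_simps)

section \<open>The submodule generated by the lowest weight vector\<close>

locale tensor_product =
  fixes \<mu> \<nu> \<epsilon> :: real and j :: nat
  assumes mu_pos: "\<mu> > 0" and nu_pos: "\<nu> > 0" and eps: "\<epsilon> \<in> {1, -1}"
begin

definition \<kappa> :: real where "\<kappa> = \<mu> + \<nu> + real j + 1/2"

definition raised :: "nat \<Rightarrow> nat \<Rightarrow> nat \<Rightarrow> real" where
  "raised N = (raise \<epsilon> ^^ N) (lowest \<mu> \<nu> \<epsilon> j)"

lemma eps_sq: "\<epsilon> * (\<epsilon> * x) = x" "\<epsilon> * \<epsilon> = 1"
  using eps by auto

lemma raised_0: "raised 0 = lowest \<mu> \<nu> \<epsilon> j"
  by (simp add: raised_def)

lemma raised_Suc: "raised (Suc N) = raise \<epsilon> (raised N)"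
  by (simp add: raised_def)

lemma raised_grade: "m + n \<noteq> N + j \<Longrightarrow> raised N m n = 0"
proof (induction N arbitrary: m n)
  case 0
  then show ?case by (simp add: raised_0 lowest_def)
next
  case (Suc N)
  then show ?case by (simp add: raised_Suc raise_def)
qed

text \<open>For \<open>m = 0\<close> raising only shifts \<open>n\<close>, so this coordinate keeps
  its initial value. It is the starting value of the dual Hahn recurrence.\<close>

lemma raised_left: "raised N 0 (N + j) = 1 / mu_fact j \<nu>"
  by (induction N) (simp_all add: raised_0 lowest_def raised_Suc raise_def)

lemma lower_lowest: "lower \<mu> \<nu> \<epsilon> (lowest \<mu> \<nu> \<epsilon> j) m n = 0"
proof (cases "Suc (m + n) = j")
  case True
  have nz: "mu_fact m \<mu> \<noteq> 0" "mu_fact n \<nu> \<noteq> 0" "mu_num (Suc m) \<mu> \<noteq> 0" "mu_num (Suc n) \<nu> \<noteq> 0"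
    using mu_fact_pos[OF mu_pos, of m] mu_fact_pos[OF nu_pos, of n]
      mu_num_pos[OF mu_pos, of "Suc m"] mu_num_pos[OF nu_pos, of "Suc n"] by auto
  \<comment> \<open>As \<open>j = m + n + 1\<close>, the exponents differ by the odd number
    \<open>2 * (m + n) + 1\<close>; hence the two terms of \<open>lower\<close> are
    opposite.\<close>
  have exps: "(-1 :: real) ^ n * (-1) ^ (j * Suc m + Suc m * (Suc m - 1) div 2)
      = - ((-1) ^ (j * m + m * (m - 1) div 2))"
  proof -
    have "n + (j * Suc m + Suc m * (Suc m - 1) div 2) = Suc (2 * (m + n)) + (j * m + m * (m - 1) div 2)"
      unfolding diff_Suc_1 Suc_choose_two_div True[symmetric] by simp
    then show ?thesis
      by (metis (no_types) power_add power_Suc power_mult power2_minus power_one mult_1_right mult_minus1)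
  qed
  have "lower \<mu> \<nu> \<epsilon> (lowest \<mu> \<nu> \<epsilon> j) m n
     = \<epsilon> * \<epsilon> * \<epsilon> ^ m * ((-1) ^ n * (-1) ^ (j * Suc m + Suc m * (Suc m - 1) div 2)) / (mu_fact m \<mu> * mu_fact n \<nu>)
      + \<epsilon> ^ m * (-1) ^ (j * m + m * (m - 1) div 2) / (mu_fact m \<mu> * mu_fact n \<nu>)"
    using True nz by (simp add: lower_def lowest_def mu_fact_Suc mult_ac)
  also have "\<dots> = 0"
    unfolding exps eps_sq by simp
  finally show ?thesis .
qed (simp add: lower_def lowest_def)

text \<open>Induction by the anticommutator: in grade \<open>N + j\<close> it is the scalar
  \<open>2 * (N + j + 1 + \<mu> + \<nu>)\<close>, which equals
  \<open>mu_num (Suc N) \<kappa> + mu_num N \<kappa>\<close>. The summand 1/2 in \<kappa> is what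
  makes this identity hold.\<close>

lemma lower_raised_Suc: "lower \<mu> \<nu> \<epsilon> (raised (Suc N)) m n = mu_num (Suc N) \<kappa> * raised N m n"
proof (induction N arbitrary: m n)
  case (0 m n)
  have "raise \<epsilon> (lower \<mu> \<nu> \<epsilon> (raised 0)) m n = 0"
    unfolding raised_0 by (rule raise_zero) (rule lower_lowest)
  then have *: "lower \<mu> \<nu> \<epsilon> (raised (Suc 0)) m n = 2 * (real m + real n + 1 + \<mu> + \<nu>) * raised 0 m n"
    using raise_lower_anticommutator[OF eps, of \<mu> \<nu> "raised 0" m n] by (simp add: raised_Suc)
  show ?case
  proof (cases "m + n = j")
    case True
    then have "2 * (real m + real n + 1 + \<mu> + \<nu>) = mu_num (Suc 0) \<kappa>"
      using mu_num_Suc_add[of 0 \<kappa>] by (simp add: \<kappa>_def flip: of_nat_add)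
    then show ?thesis
      using * by simp
  next
    case False
    then show ?thesis
      using * raised_grade[of m n 0] by simp
  qed
next
  case (Suc N m n)
  have "raise \<epsilon> (lower \<mu> \<nu> \<epsilon> (raised (Suc N))) m n = mu_num (Suc N) \<kappa> * raised (Suc N) m n"
    unfolding raised_Suc[of N] by (rule raise_cmult) (fact Suc.IH[unfolded raised_Suc])
  then have *: "lower \<mu> \<nu> \<epsilon> (raised (Suc (Suc N))) m n
      = (2 * (real m + real n + 1 + \<mu> + \<nu>) - mu_num (Suc N) \<kappa>) * raised (Suc N) m n"
    using raise_lower_anticommutator[OF eps, of \<mu> \<nu> "raised (Suc N)" m n]
    by (simp add: raised_Suc[of "Suc N"] algebra_simps)
  show ?case
  proof (cases "m + n = Suc N + j")
    case True
    then have "real m + real n = real N + real j + 1"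
      by linarith
    then have "2 * (real m + real n + 1 + \<mu> + \<nu>) - mu_num (Suc N) \<kappa> = mu_num (Suc (Suc N)) \<kappa>"
      using mu_num_Suc_add[of "Suc N" \<kappa>] by (simp add: \<kappa>_def)
    then show ?thesis
      using * by simp
  next
    case False
    then show ?thesis
      using * raised_grade[OF False] by simp
  qed
qed

text \<open>The Casimir relation: its coordinates are the dual \<open>-1\<close> Hahn recurrence.\<close>

lemma raise_lower_raised: "raise \<epsilon> (lower \<mu> \<nu> \<epsilon> (raised N)) m n = mu_num N \<kappa> * raised N m n"
proof (cases N)
  case 0
  then show ?thesis
    using raise_zero[OF lower_lowest] by (simp add: raised_0)
next
  case (Suc k)
  show ?thesis
    unfolding Suc unfolding raised_Suc[of k]
    by (rule raise_cmult) (fact lower_raised_Suc[unfolded raised_Suc])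
qed

text \<open>The Casimir relation at position \<open>(m, Suc n)\<close> couples three neighbouring
  coordinates of one grade; it is solved for the one with the largest first index.\<close>

lemma raised_recurrence:
  "mu_num (Suc m) \<mu> * raised N (Suc m) n
    = \<epsilon> * (-1) ^ n * (mu_num N \<kappa> - mu_num m \<mu> - mu_num (Suc n) \<nu>) * raised N m (Suc n)
      + (if m = 0 then 0 else mu_num (Suc (Suc n)) \<nu> * raised N (m - 1) (Suc (Suc n)))"
proof -
  have "mu_num N \<kappa> * raised N m (Suc n)
    = \<epsilon> * (-1) ^ n * mu_num (Suc m) \<mu> * raised N (Suc m) n
      + (mu_num m \<mu> + mu_num (Suc n) \<nu>) * raised N m (Suc n)
      - (if m = 0 then 0 else \<epsilon> * (-1) ^ n * mu_num (Suc (Suc n)) \<nu> * raised N (m - 1) (Suc (Suc n)))"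
    unfolding raise_lower_raised[symmetric]
    by (cases m) (simp_all add: raise_def lower_def algebra_simps eps_sq)
  then have "\<epsilon> * (-1) ^ n * mu_num (Suc m) \<mu> * raised N (Suc m) n
    = (mu_num N \<kappa> - mu_num m \<mu> - mu_num (Suc n) \<nu>) * raised N m (Suc n)
      + (if m = 0 then 0 else \<epsilon> * (-1) ^ n * mu_num (Suc (Suc n)) \<nu> * raised N (m - 1) (Suc (Suc n)))"
    by (simp add: algebra_simps)
  \<comment> \<open>The factor \<open>\<epsilon> * (-1) ^ n\<close> is its own inverse, so
    multiplying by it isolates the leading term.\<close>
  then have "\<epsilon> * (-1) ^ n * (\<epsilon> * (-1) ^ n * mu_num (Suc m) \<mu> * raised N (Suc m) n)
    = \<epsilon> * (-1) ^ n * ((mu_num N \<kappa> - mu_num m \<mu> - mu_num (Suc n) \<nu>) * raised N m (Suc n)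
      + (if m = 0 then 0 else \<epsilon> * (-1) ^ n * mu_num (Suc (Suc n)) \<nu> * raised N (m - 1) (Suc (Suc n))))"
    by simp
  then show ?thesis
    by (simp add: algebra_simps eps_sq split: if_splits)
qed

section \<open>Coordinates as dual -1 Hahn polynomials\<close>

definition hahn_sign :: "nat \<Rightarrow> nat \<Rightarrow> real" where
  "hahn_sign M n = (-1) ^ (n * (n - 1) div 2 + n * (M + 1))"

text \<open>In grade \<open>M\<close>, the step of \<open>raised_recurrence\<close> from first index
  \<open>n\<close> to \<open>n + 1\<close> carries the sign \<open>(-1) ^ (M - n - 1)\<close>, of
  the same parity as here; \<open>hahn_sign\<close> accumulates these signs.\<close>

lemma hahn_sign_Suc: "hahn_sign M (Suc n) = (-1) ^ (n + M + 1) * hahn_sign M n"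
  unfolding hahn_sign_def diff_Suc_1 Suc_choose_two_div by (simp add: power_add)

text \<open>In grade \<open>N + j\<close> the point \<open>z_j\<close> is
  \<open>- (-1) ^ N * 2 * \<kappa>\<close>, the alternating part of
  \<open>2 * mu_num N \<kappa>\<close>, and \<open>hahn_b\<close> carries the alternating parts of
  the other two numbers. What is left on the right is
  \<open>2 * (\<kappa> - j - \<mu> - \<nu>) = 1\<close>, the constant of
  \<open>hahn_b\<close>.\<close>

lemma hahn_z_minus_b:
  assumes "Suc (m + n) = N + j"
  shows "hahn_z j \<nu> \<mu> (N + j) - hahn_b m \<nu> \<mu> (N + j)
    = 2 * (mu_num N \<kappa> - mu_num m \<mu> - mu_num (Suc n) \<nu>)"
proof -
  have M: "(-1 :: real) ^ (N + j) = - ((-1) ^ m * (-1) ^ n)"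
    by (metis assms mult_minus1 power_Suc power_add)
  have z: "(-1 :: real) ^ (j + (N + j) + 1) = - ((-1) ^ N)"
    by (simp add: power_add)
  have "real m + real n + 1 = real N + real j"
    using assms by linarith
  then have "real n = real N + real j - 1 - real m"
    by simp
  then show ?thesis
    unfolding hahn_z_def hahn_b_def mu_num_def \<kappa>_def M z
    by (simp add: algebra_simps)
qed

text \<open>Both sides obey the same three-term recurrence in \<open>m\<close> with the same start.
  The powers of 1/2 compensate the factor 2 in \<open>hahn_z_minus_b\<close> and the 4 in
  \<open>hahn_u\<close>; \<open>mu_fact m \<mu>\<close> collects the leading coefficients.\<close>

lemma raised_eq_dual_hahn:
  assumes "m + n = N + j"
  shows "raised N m n = raised N 0 (N + j) * hahn_sign (N + j) m * (\<epsilon> / 2) ^ m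
    * dual_hahn m (hahn_z j \<nu> \<mu> (N + j)) \<nu> \<mu> (N + j) / mu_fact m \<mu>"
  using assms
proof (induction m arbitrary: n rule: less_induct)
  case (less m)
  define M where "M = N + j"
  define C where "C = raised N 0 M"
  define R where "R m = dual_hahn m (hahn_z j \<nu> \<mu> M) \<nu> \<mu> M" for m
  have pos: "mu_fact k \<mu> > 0" "mu_num (Suc k) \<mu> > 0" for k
    using mu_fact_pos[OF mu_pos] mu_num_pos[OF mu_pos] by auto
  consider "m = 0" | "m = 1" | k where "m = Suc (Suc k)"
    by (metis One_nat_def not0_implies_Suc)
  then show ?case
  proof cases
    case 1
    then show ?thesis
      using less.prems by (simp add: hahn_sign_def)
  next
    case 2
    then have M: "N + j = Suc n"
      using less.prems by simp
    define d where "d = mu_num N \<kappa> - mu_num (Suc n) \<nu>"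
    have "mu_num 1 \<mu> * raised N 1 n = \<epsilon> * (-1) ^ n * d * raised N 0 (Suc n)"
      using raised_recurrence[of 0 N n] by (simp add: d_def)
    moreover have "hahn_z j \<nu> \<mu> (N + j) - hahn_b 0 \<nu> \<mu> (N + j) = 2 * d"
      using hahn_z_minus_b[of 0 n N] M by (simp add: d_def)
    ultimately show ?thesis
      using pos(2)[of 0] 2 by (simp add: M hahn_sign_def mu_fact_Suc field_simps)
  next
    case (3 k)
    have sum: "Suc (Suc k + n) = N + j" "Suc k + Suc n = M" "k + Suc (Suc n) = M"
      using less.prems 3 by (auto simp: M_def)
    have IH: "raised N (Suc k) (Suc n) = C * hahn_sign M (Suc k) * (\<epsilon> / 2) ^ Suc k * R (Suc k) / mu_fact (Suc k) \<mu>"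
        "raised N k (Suc (Suc n)) = C * hahn_sign M k * (\<epsilon> / 2) ^ k * R k / mu_fact k \<mu>"
      using less.IH[of "Suc k" "Suc n"] less.IH[of k "Suc (Suc n)"] sum 3
      by (simp_all add: C_def R_def M_def)
    \<comment> \<open>From \<open>k + n + 2 = M\<close>, the sign step at \<open>k\<close> is
      \<open>- ((-1) ^ n)\<close> and the next one is \<open>(-1) ^ n\<close>, so two steps together
      give a factor -1.\<close>
    have s1: "hahn_sign M (Suc k) = (-1) ^ n * hahn_sign M k * (-1) "
    proof -
      have "(-1 :: real) ^ (k + M + 1) = - ((-1) ^ n)"
        unfolding sum(3)[symmetric] by (simp add: power_add)
      then show ?thesis
        by (simp add: hahn_sign_Suc)
    qed
    have s2: "hahn_sign M (Suc (Suc k)) = - hahn_sign M k"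
    proof -
      have "(-1 :: real) ^ (Suc k + M + 1) = (-1) ^ n"
        unfolding sum(3)[symmetric] by (simp add: power_add)
      then show ?thesis
        by (simp add: hahn_sign_Suc[of M "Suc k"] s1)
    qed
    define d where "d = mu_num N \<kappa> - mu_num (Suc k) \<mu> - mu_num (Suc n) \<nu>"
    \<comment> \<open>In grade \<open>M\<close> the subtraction \<open>M + 1 - Suc k\<close> inside
      \<open>hahn_u\<close> equals \<open>n + 2\<close>.\<close>
    have R2: "R (Suc (Suc k)) = 2 * d * R (Suc k) - 4 * mu_num (Suc k) \<mu> * mu_num (Suc (Suc n)) \<nu> * R k"
      using hahn_z_minus_b[of "Suc k" n N] sum
      by (simp add: R_def M_def hahn_u_def d_def Suc_diff_le flip: sum(3)[unfolded M_def])
    have "mu_num (Suc (Suc k)) \<mu> * raised N (Suc (Suc k)) n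
      = \<epsilon> * (-1) ^ n * d * raised N (Suc k) (Suc n) + mu_num (Suc (Suc n)) \<nu> * raised N k (Suc (Suc n))"
      using raised_recurrence[of "Suc k" N n] by (simp add: d_def)
    also have "\<dots> = - C * hahn_sign M k * (\<epsilon> / 2) ^ Suc (Suc k) * R (Suc (Suc k)) / mu_fact (Suc k) \<mu>"
      unfolding IH s1 R2 using pos(1)[of k] pos(2)[of k]
      by (simp add: mu_fact_Suc field_simps eps_sq)
    finally have "raised N (Suc (Suc k)) n
      = - C * hahn_sign M k * (\<epsilon> / 2) ^ Suc (Suc k) * R (Suc (Suc k)) / mu_fact (Suc k) \<mu> / mu_num (Suc (Suc k)) \<mu>"
      by (metis less_irrefl nonzero_mult_div_cancel_left pos(2))
    then show ?thesis
      by (simp add: 3 s2 mu_fact_Suc[of "Suc k"] mult_ac flip: M_def C_def R_def)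
  qed
qed

text \<open>On the vectors \<open>raised k\<close>, raising is the shift and lowering returns
  \<open>mu_num k \<kappa>\<close> times the previous vector. Hence
  \<open>pairing_recurrence\<close> becomes the monic Chihara recurrence in \<open>N\<close> with
  parameter \<kappa>, whose solution is fixed by the value at \<open>N = 0\<close>.\<close>

lemma pairing_raised:
  fixes \<delta> c x y :: real
  defines "f \<equiv> \<lambda>n. monic_chihara n x \<mu> (c * \<delta>)" and "g \<equiv> \<lambda>n. monic_chihara n y \<nu> (x * \<epsilon>)"
  shows "pairing f g (N + j) (raised N)
    = monic_chihara N y \<kappa> (c * (\<delta> * \<epsilon> * (-1) ^ j)) * pairing f g j (lowest \<mu> \<nu> \<epsilon> j)"
proof (induction N rule: less_induct)
  case (less N)
  define \<gamma> where "\<gamma> = c * (\<delta> * \<epsilon> * (-1) ^ j)"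
  define S where "S = pairing f g j (lowest \<mu> \<nu> \<epsilon> j)"
  have kappa: "\<kappa> > 0"
    using mu_pos nu_pos by (simp add: \<kappa>_def)
  have rec: "pairing f g (Suc k + j) (raised (Suc k)) = (y - \<gamma> * (-1) ^ k) * pairing f g (k + j) (raised k)
      - (if k + j = 0 then 0 else pairing f g (k + j - 1) (lower \<mu> \<nu> \<epsilon> (raised k)))" for k
    using pairing_recurrence[OF mu_pos nu_pos, of y x c \<delta> \<epsilon> "k + j" "raised k"]
    by (simp add: raised_Suc f_def g_def \<gamma>_def power_add algebra_simps)
  have mon: "monic_chihara (Suc k) y \<kappa> \<gamma> = (y - \<gamma> * (-1) ^ k) * monic_chihara k y \<kappa> \<gamma>
      - mu_num k \<kappa> * monic_chihara (k - 1) y \<kappa> \<gamma>" for k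
    using monic_chihara_recurrence[OF kappa, of y k \<gamma>] by (simp add: algebra_simps)
  show ?case
  proof (cases N)
    case 0
    then show ?thesis by (simp add: raised_0)
  next
    case (Suc k)
    \<comment> \<open>For \<open>k = 0\<close> the left side vanishes because the vector is lowest,
      the right side through \<open>mu_num 0 \<kappa>\<close>.\<close>
    have low: "(if k + j = 0 then 0 else pairing f g (k + j - 1) (lower \<mu> \<nu> \<epsilon> (raised k)))
        = mu_num k \<kappa> * monic_chihara (k - 1) y \<kappa> \<gamma> * S"
    proof (cases k)
      case 0
      then show ?thesis
        by (simp add: raised_0 pairing_def lower_lowest)
    next
      case (Suc i)
      have "pairing f g (i + j) (lower \<mu> \<nu> \<epsilon> (raised (Suc i))) = mu_num (Suc i) \<kappa> * pairing f g (i + j) (raised i)"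
        by (rule pairing_cmult) (rule lower_raised_Suc)
      then show ?thesis
        using less.IH[of i] Suc \<open>N = Suc k\<close> by (simp add: S_def \<gamma>_def)
    qed
    show ?thesis
      unfolding Suc rec low mon[of k, unfolded \<gamma>_def]
      using less.IH[of k] Suc by (simp add: S_def \<gamma>_def algebra_simps)
  qed
qed

end

section \<open>Terminating hypergeometric sums\<close>

definition jacobi_sum :: "nat \<Rightarrow> real \<Rightarrow> real \<Rightarrow> real \<Rightarrow> real" where
  "jacobi_sum m p q y = (\<Sum>i\<le>m. (-1) ^ i * real (m choose i) * pochhammer p i / pochhammer q i * y ^ i)"

text \<open>The quotient \<open>pochhammer (- real m) i / fact i\<close> is a signed binomial
  coefficient, which vanishes beyond \<open>m\<close>.\<close>

lemma hyp2F1_terminating: "hyp2F1 (- real m) p q y = jacobi_sum m p q y"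
proof -
  have b: "pochhammer (- real m) i = (-1) ^ i * (real (m choose i) * fact i)" for i
    by (simp add: binomial_gbinomial gbinomial_pochhammer flip: power_mult_distrib)
  have "hyp2F1 (- real m) p q y = (\<Sum>i\<le>m. pochhammer (- real m) i * pochhammer p i / (pochhammer q i * fact i) * y ^ i)"
    unfolding hyp2F1_eq_suminf by (rule suminf_finite) (auto simp: b)
  also have "\<dots> = jacobi_sum m p q y"
    unfolding jacobi_sum_def b by (intro sum.cong) auto
  finally show ?thesis .
qed

text \<open>Coefficientwise from \<open>(p+1)_(i+1) - (p)_(i+1) = (i+1) (p+1)_i\<close> and
  absorption of \<open>i + 1\<close> into the binomial. It serves even degrees, where the pairing
  yields the upper parameter \<open>p\<close> but the big -1 Jacobi polynomial has
  \<open>p + 1\<close>.\<close>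

lemma jacobi_sum_shift_upper:
  assumes "q > 0"
  shows "jacobi_sum (Suc m) (p + 1) q y
    = jacobi_sum (Suc m) p q y - real (Suc m) * y / q * jacobi_sum m (p + 1) (q + 1) y"
proof -
  have *: "(-1) ^ Suc i * real (Suc m choose Suc i) * pochhammer (p + 1) (Suc i) / pochhammer q (Suc i) * y ^ Suc i
    = (-1) ^ Suc i * real (Suc m choose Suc i) * pochhammer p (Suc i) / pochhammer q (Suc i) * y ^ Suc i
      - real (Suc m) * y / q * ((-1) ^ i * real (m choose i) * pochhammer (p + 1) i / pochhammer (q + 1) i * y ^ i)" for i
  proof -
    have "pochhammer (p + 1) (Suc i) - pochhammer p (Suc i) = real (Suc i) * pochhammer (p + 1) i"
      unfolding pochhammer_Suc[of "p + 1"] pochhammer_rec[of p] by (simp add: algebra_simps)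
    then have 1: "pochhammer (p + 1) (Suc i) = pochhammer p (Suc i) + real (Suc i) * pochhammer (p + 1) i"
      by simp
    have 2: "real (Suc m choose Suc i) * real (Suc i) = real (Suc m) * real (m choose i)"
      by (metis Suc_times_binomial_eq of_nat_mult)
    have "(-1) ^ Suc i * real (Suc m choose Suc i) * pochhammer (p + 1) (Suc i) / pochhammer q (Suc i) * y ^ Suc i
      = (-1) ^ Suc i * real (Suc m choose Suc i) * pochhammer p (Suc i) / pochhammer q (Suc i) * y ^ Suc i
       - (real (Suc m choose Suc i) * real (Suc i)) * ((-1) ^ i * pochhammer (p + 1) i / pochhammer q (Suc i) * y ^ Suc i)"
      unfolding 1 by (simp add: algebra_simps add_divide_distrib diff_divide_distrib)
    then show ?thesis
      unfolding 2 pochhammer_rec[of q] using assms by simp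
  qed
  show ?thesis
    unfolding jacobi_sum_def
    by (subst (1 2) sum.atMost_Suc_shift, subst *)
       (simp add: sum_subtractf sum_distrib_left)
qed

text \<open>Termwise from \<open>p (p+1)_i = (p+i) (p)_i\<close>,
  \<open>q / (q)_i = (q+i) / (q+1)_i\<close> and \<open>p + i = (q + i) + (p - q)\<close>. It serves
  odd degrees.\<close>

lemma jacobi_sum_contiguous:
  assumes "q > 0"
  shows "p * jacobi_sum m (p + 1) (q + 1) y = q * jacobi_sum m p q y + (p - q) * jacobi_sum m p (q + 1) y"
  unfolding jacobi_sum_def sum_distrib_left sum.distrib[symmetric]
proof (rule sum.cong[OF refl])
  fix i
  have 1: "p * pochhammer (p + 1) i = (p + real i) * pochhammer p i"
    by (metis mult.commute pochhammer_Suc pochhammer_rec)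
  have 2: "q * pochhammer (q + 1) i = (q + real i) * pochhammer q i"
    by (metis mult.commute pochhammer_Suc pochhammer_rec)
  have pos: "pochhammer q i > 0" "pochhammer (q + 1) i > 0" "q + real i > 0"
    using assms by (auto intro: pochhammer_pos)
  then have 3: "q / pochhammer q i = (q + real i) / pochhammer (q + 1) i"
    using 2 by (simp add: divide_simps mult.commute)
  define t where "t = (-1) ^ i * real (m choose i) * y ^ i"
  have "p * (t * pochhammer (p + 1) i / pochhammer (q + 1) i)
    = t * (p * pochhammer (p + 1) i) / pochhammer (q + 1) i" by simp
  also have "\<dots> = t * pochhammer p i * ((q + real i) / pochhammer (q + 1) i + (p - q) / pochhammer (q + 1) i)"
    unfolding 1 by (simp add: algebra_simps flip: add_divide_distrib)
  also have "\<dots> = t * pochhammer p i * (q / pochhammer q i + (p - q) / pochhammer (q + 1) i)"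
    unfolding 3 ..
  finally show "p * ((-1) ^ i * real (m choose i) * pochhammer (p + 1) i / pochhammer (q + 1) i * y ^ i)
    = q * ((-1) ^ i * real (m choose i) * pochhammer p i / pochhammer q i * y ^ i)
      + (p - q) * ((-1) ^ i * real (m choose i) * pochhammer p i / pochhammer (q + 1) i * y ^ i)"
    by (simp add: t_def algebra_simps)
qed

text \<open>The Chu-Vandermonde sum in disguise: over the common denominator
  \<open>n! (a)_n (b)_n\<close> the numerators are complementary Pochhammer symbols, which
  reflection turns into symbols with the fixed bases \<open>1 - b - n\<close> and
  \<open>1 - a - n\<close>.\<close>

lemma pochhammer_vandermonde_reciprocal:
  fixes a b :: real
  assumes "a > 0" "b > 0"
  shows "(\<Sum>k\<le>n. 1 / (fact k * fact (n - k) * pochhammer a k * pochhammer b (n - k)))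
    = pochhammer (a + b + real n - 1) n / (fact n * pochhammer a n * pochhammer b n)"
proof -
  have refl': "pochhammer (1 - c - real n) k = (-1) ^ k * pochhammer (c + real (n - k)) k"
    if "k \<le> n" for c :: real and k
    using pochhammer_minus[of "c + real n - 1" k] that by (simp add: of_nat_diff algebra_simps)
  have "pochhammer (a + b + real n - 1) n = (-1) ^ n * pochhammer ((1 - a - real n) + (1 - b - real n)) n"
    using pochhammer_minus[of "a + b + 2 * real n - 2" n]
    by (simp add: algebra_simps flip: power_mult_distrib)
  also have "\<dots> = (-1) ^ n * (\<Sum>k\<le>n. real (n choose k) * pochhammer (1 - b - real n) k * pochhammer (1 - a - real n) (n - k))"
    unfolding add.commute[of "1 - a - real n"] pochhammer_binomial_sum ..
  also have "\<dots> = (\<Sum>k\<le>n. real (n choose k) * pochhammer (b + real (n - k)) k * pochhammer (a + real k) (n - k))"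
    unfolding sum_distrib_left
  proof (rule sum.cong[OF refl])
    fix k assume "k \<in> {..n}"
    then have k: "k \<le> n" by simp
    then have "(-1 :: real) ^ n * ((-1) ^ k * (-1) ^ (n - k)) = 1"
      by (simp flip: power_add)
    then show "(-1) ^ n * (real (n choose k) * pochhammer (1 - b - real n) k * pochhammer (1 - a - real n) (n - k))
      = real (n choose k) * pochhammer (b + real (n - k)) k * pochhammer (a + real k) (n - k)"
      using k by (simp add: refl' mult_ac)
  qed
  finally have *: "pochhammer (a + b + real n - 1) n = \<dots>" .
  have "(\<Sum>k\<le>n. 1 / (fact k * fact (n - k) * pochhammer a k * pochhammer b (n - k)))
    = (\<Sum>k\<le>n. real (n choose k) * pochhammer (b + real (n - k)) k * pochhammer (a + real k) (n - k)
        / (fact n * pochhammer a n * pochhammer b n))"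
  proof (rule sum.cong[OF refl])
    fix k assume "k \<in> {..n}"
    then have k: "k \<le> n" by simp
    have pos: "pochhammer (a + real k) (n - k) > 0" "pochhammer (b + real (n - k)) k > 0"
      using assms by (auto intro!: pochhammer_pos add_pos_nonneg)
    have pa: "pochhammer a n = pochhammer a k * pochhammer (a + real k) (n - k)"
      using k by (rule pochhammer_product)
    have pb: "pochhammer b n = pochhammer b (n - k) * pochhammer (b + real (n - k)) k"
      using pochhammer_product[of "n - k" n b] k by simp
    show "1 / (fact k * fact (n - k) * pochhammer a k * pochhammer b (n - k))
      = real (n choose k) * pochhammer (b + real (n - k)) k * pochhammer (a + real k) (n - k)
        / (fact n * pochhammer a n * pochhammer b n)"
      using pos k unfolding pa pb by (simp add: binomial_fact del: of_nat_diff)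
  qed
  then show ?thesis
    unfolding * sum_divide_distrib .
qed

text \<open>At \<open>u = (1 - t) / 2\<close> and \<open>w = (1 + t) / 2\<close> this is the Jacobi
  polynomial in \<open>t\<close> with parameters \<open>a - 1\<close> and \<open>b - 1\<close>,
  divided by \<open>(a)_m (b)_m\<close>.\<close>

definition two_var_jacobi :: "nat \<Rightarrow> real \<Rightarrow> real \<Rightarrow> real \<Rightarrow> real \<Rightarrow> real" where
  "two_var_jacobi m a b u w
    = (\<Sum>k\<le>m. (- u) ^ k * w ^ (m - k) / (fact k * fact (m - k) * pochhammer a k * pochhammer b (m - k)))"

text \<open>Write \<open>- u = - v + w\<close> with \<open>v = u + w\<close> and expand. For each
  power of \<open>v\<close> the inner sum over \<open>k\<close> is evaluated by the reciprocal
  Vandermonde identity.\<close>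

lemma two_var_jacobi_eq:
  assumes "a > 0" "b > 0" "u + w \<noteq> 0"
  shows "two_var_jacobi m a b u w
    = (- (u + w)) ^ m / (fact m * pochhammer a m) * jacobi_sum m (real m + a + b - 1) b (w / (u + w))"
proof -
  define v where "v = u + w"
  define D where "D k = fact k * fact (m - k) * pochhammer a k * pochhammer b (m - k)" for k
  have "two_var_jacobi m a b u w
    = (\<Sum>k\<le>m. \<Sum>l\<le>m. real (k choose l) * (- v) ^ l * w ^ (m - l) / D k)"
    unfolding two_var_jacobi_def
  proof (rule sum.cong[OF refl])
    fix k assume "k \<in> {..m}"
    then have k: "k \<le> m" by simp
    have "(- u) ^ k = (- v + w) ^ k"
      by (simp add: v_def)
    also have "\<dots> = (\<Sum>l\<le>k. real (k choose l) * (- v) ^ l * w ^ (k - l))"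
      by (rule binomial_ring)
    finally have "(- u) ^ k * w ^ (m - k) / D k
      = (\<Sum>l\<le>k. real (k choose l) * (- v) ^ l * w ^ (m - l) / D k)"
      using k by (simp add: sum_distrib_right sum_divide_distrib mult.assoc flip: power_add)
    \<comment> \<open>Binomials with \<open>l > k\<close> vanish, so both indices may run over the
      same range and the sums can be exchanged.\<close>
    also have "\<dots> = (\<Sum>l\<le>m. real (k choose l) * (- v) ^ l * w ^ (m - l) / D k)"
      using k by (intro sum.mono_neutral_left) (auto simp: binomial_eq_0)
    finally show "(- u) ^ k * w ^ (m - k) / (fact k * fact (m - k) * pochhammer a k * pochhammer b (m - k)) = \<dots>"
      unfolding D_def .
  qed
  also have "\<dots> = (\<Sum>l\<le>m. \<Sum>k\<le>m. real (k choose l) * (- v) ^ l * w ^ (m - l) / D k)"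
    by (rule sum.swap)
  also have "\<dots> = (\<Sum>l\<le>m. (- v) ^ l * w ^ (m - l) * (pochhammer (a + b + real m - 1) (m - l)
      / (fact l * fact (m - l) * pochhammer a m * pochhammer b (m - l))))"
  proof (rule sum.cong[OF refl])
    fix l assume "l \<in> {..m}"
    then have l: "l \<le> m" by simp
    have "(\<Sum>k\<le>m. real (k choose l) / D k) = (\<Sum>k\<in>{l..m}. real (k choose l) / D k)"
      by (rule sum.mono_neutral_right) (auto simp: binomial_eq_0)
    also have "\<dots> = (\<Sum>k\<le>m - l. real (l + k choose l) / D (l + k))"
      using l by (intro sum.reindex_bij_witness[of _ "\<lambda>k. l + k" "\<lambda>k. k - l"]) auto
    \<comment> \<open>Now \<open>k\<close> is the excess over \<open>l\<close>, and splitting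
      \<open>(a)_(l+k)\<close> at \<open>l\<close> leaves the Vandermonde sum of length
      \<open>m - l\<close> with \<open>a + l\<close> in place of \<open>a\<close>.\<close>
    also have "\<dots> = (\<Sum>k\<le>m - l. 1 / (fact l * pochhammer a l)
        * (1 / (fact k * fact (m - l - k) * pochhammer (a + real l) k * pochhammer b (m - l - k))))"
    proof (rule sum.cong[OF refl])
      fix k assume "k \<in> {..m - l}"
      then have k: "k \<le> m - l" by simp
      have "pochhammer a (l + k) = pochhammer a l * pochhammer (a + real l) k"
        by (rule pochhammer_product')
      then show "real (l + k choose l) / D (l + k) = 1 / (fact l * pochhammer a l)
        * (1 / (fact k * fact (m - l - k) * pochhammer (a + real l) k * pochhammer b (m - l - k)))"
        by (simp add: D_def binomial_fact)
    qed
    also have "\<dots> = 1 / (fact l * pochhammer a l) * (pochhammer (a + real l + b + real (m - l) - 1) (m - l)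
        / (fact (m - l) * pochhammer (a + real l) (m - l) * pochhammer b (m - l)))"
      unfolding sum_distrib_left[symmetric]
      by (subst pochhammer_vandermonde_reciprocal) (use assms in auto)
    also have "\<dots> = pochhammer (a + b + real m - 1) (m - l)
      / (fact l * fact (m - l) * pochhammer a m * pochhammer b (m - l))"
    proof -
      have "a + real l + b + real (m - l) - 1 = a + b + real m - 1"
        using l by (simp add: of_nat_diff)
      then show ?thesis
        by (simp only: pochhammer_product[OF l, of a]) simp
    qed
    finally have *: "(\<Sum>k\<le>m. real (k choose l) / D k) = \<dots>" .
    have "(\<Sum>k\<le>m. real (k choose l) * (- v) ^ l * w ^ (m - l) / D k)
      = (- v) ^ l * w ^ (m - l) * (\<Sum>k\<le>m. real (k choose l) / D k)"
      unfolding sum_distrib_left by (intro sum.cong) simp_all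
    then show "(\<Sum>k\<le>m. real (k choose l) * (- v) ^ l * w ^ (m - l) / D k)
      = (- v) ^ l * w ^ (m - l) * (pochhammer (a + b + real m - 1) (m - l)
      / (fact l * fact (m - l) * pochhammer a m * pochhammer b (m - l)))"
      unfolding * .
  qed
  also have "\<dots> = (\<Sum>i\<le>m. (- v) ^ (m - i) * w ^ i * (pochhammer (a + b + real m - 1) i
      / (fact (m - i) * fact i * pochhammer a m * pochhammer b i)))"
    by (rule sum.reindex_bij_witness[of _ "\<lambda>i. m - i" "\<lambda>i. m - i"]) auto
  also have "\<dots> = (- v) ^ m / (fact m * pochhammer a m) * jacobi_sum m (real m + a + b - 1) b (w / v)"
    unfolding jacobi_sum_def sum_distrib_left
  proof (rule sum.cong[OF refl])
    fix i assume "i \<in> {..m}"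
    then have i: "i \<le> m" by simp
    have "(- v) ^ m = (- v) ^ (m - i) * (- v) ^ i"
      using i by (simp flip: power_add)
    moreover have "v \<noteq> 0"
      using assms(3) by (simp add: v_def)
    then have "- v * (-1 * (w / v)) = w"
      by simp
    then have "(- v) ^ i * ((-1) ^ i * (w / v) ^ i) = w ^ i"
      by (metis power_mult_distrib)
    ultimately have "(- v) ^ m * ((-1) ^ i * (w / v) ^ i) = (- v) ^ (m - i) * w ^ i"
      by simp
    then show "(- v) ^ (m - i) * w ^ i * (pochhammer (a + b + real m - 1) i
        / (fact (m - i) * fact i * pochhammer a m * pochhammer b i))
      = (- v) ^ m / (fact m * pochhammer a m) * ((-1) ^ i * real (m choose i)
        * pochhammer (real m + a + b - 1) i / pochhammer b i * (w / v) ^ i)"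
      using i by (simp add: binomial_fact algebra_simps)
  qed
  finally show ?thesis
    unfolding v_def .
qed

section \<open>Laguerre form of the Chihara polynomials\<close>

definition bessel_fps :: "real \<Rightarrow> real \<Rightarrow> real fps" where
  "bessel_fps a u = Abs_fps (\<lambda>i. (u / 4) ^ i / (fact i * pochhammer a i))"

text \<open>The coefficient of degree \<open>n\<close> is \<open>(- 1/2) ^ n / (a)_n\<close> times
  the Laguerre polynomial of degree \<open>n\<close> and parameter \<open>a - 1\<close> at
  \<open>u / 2\<close>.\<close>

definition laguerre_fps :: "real \<Rightarrow> real \<Rightarrow> real fps" where
  "laguerre_fps a u = fps_exp (- 1 / 2) * bessel_fps a u"

text \<open>The operator \<open>t d/dt + a\<close> multiplies the coefficient of index
  \<open>n\<close> by \<open>n + a\<close>, and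
  \<open>(n + a) / (a+1)_n = a / (a)_n\<close>.\<close>

lemma bessel_fps_shift:
  assumes "a > 0"
  shows "fps_X * fps_deriv (bessel_fps (a + 1) u) + fps_const a * bessel_fps (a + 1) u
    = fps_const a * bessel_fps a u"
proof (rule fps_ext)
  fix n
  have "a * pochhammer (a + 1) n = (a + real n) * pochhammer a n"
    by (metis mult.commute pochhammer_Suc pochhammer_rec)
  moreover have "pochhammer a n > 0" "pochhammer (a + 1) n > 0"
    using assms by (auto intro: pochhammer_pos)
  ultimately have *: "(real n + a) / pochhammer (a + 1) n = a / pochhammer a n"
    by (simp add: divide_simps mult_ac add.commute)
  have "fps_nth (fps_X * fps_deriv (bessel_fps (a + 1) u) + fps_const a * bessel_fps (a + 1) u) n
      = (real n + a) * fps_nth (bessel_fps (a + 1) u) n"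
    by (cases n) (simp_all add: algebra_simps)
  also have "\<dots> = (u / 4) ^ n / fact n * ((real n + a) / pochhammer (a + 1) n)"
    by (simp add: bessel_fps_def)
  finally show "fps_nth (fps_X * fps_deriv (bessel_fps (a + 1) u) + fps_const a * bessel_fps (a + 1) u) n
      = fps_nth (fps_const a * bessel_fps a u) n"
    unfolding * by (simp add: bessel_fps_def)
qed

lemma fps_deriv_bessel_fps:
  assumes "a > 0"
  shows "fps_deriv (bessel_fps a u) = fps_const (u / (4 * a)) * bessel_fps (a + 1) u"
  using assms
  by (intro fps_ext) (simp add: bessel_fps_def pochhammer_rec[of a] field_simps del: of_nat_Suc)

text \<open>Carried over from \<open>bessel_fps_shift\<close>: \<open>t d/dt\<close> on the
  exponential factor yields an extra \<open>- t / 2\<close>, hence the coefficient of index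
  \<open>n - 1\<close>.\<close>

lemma laguerre_fps_shift:
  assumes "a > 0"
  shows "2 * a * fps_nth (laguerre_fps a u) n
    = (2 * real n + 2 * a) * fps_nth (laguerre_fps (a + 1) u) n
      + (if n = 0 then 0 else fps_nth (laguerre_fps (a + 1) u) (n - 1))"
proof -
  have "fps_X * fps_deriv (laguerre_fps (a + 1) u) + fps_const a * laguerre_fps (a + 1) u
    = fps_exp (- 1 / 2) * (fps_X * fps_deriv (bessel_fps (a + 1) u) + fps_const a * bessel_fps (a + 1) u)
      - fps_const (1 / 2) * (fps_X * laguerre_fps (a + 1) u)"
    unfolding laguerre_fps_def fps_deriv_mult by (simp add: algebra_simps flip: fps_const_neg)
  also have "\<dots> = fps_const a * laguerre_fps a u - fps_const (1 / 2) * (fps_X * laguerre_fps (a + 1) u)"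
    unfolding bessel_fps_shift[OF assms] laguerre_fps_def by (simp add: mult_ac)
  finally have "fps_nth (fps_X * fps_deriv (laguerre_fps (a + 1) u) + fps_const a * laguerre_fps (a + 1) u) n
    = fps_nth (fps_const a * laguerre_fps a u - fps_const (1 / 2) * (fps_X * laguerre_fps (a + 1) u)) n"
    by simp
  then show ?thesis
    by (cases n) (auto simp: algebra_simps)
qed

lemma laguerre_fps_Suc:
  assumes "a > 0"
  shows "2 * real (Suc n) * fps_nth (laguerre_fps a u) (Suc n)
    = u / (2 * a) * fps_nth (laguerre_fps (a + 1) u) n - fps_nth (laguerre_fps a u) n"
proof -
  have "fps_deriv (laguerre_fps a u)
    = fps_const (u / (4 * a)) * laguerre_fps (a + 1) u - fps_const (1 / 2) * laguerre_fps a u"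
    unfolding laguerre_fps_def fps_deriv_mult fps_deriv_bessel_fps[OF assms]
    by (simp add: algebra_simps flip: fps_const_neg)
  then have "fps_nth (fps_deriv (laguerre_fps a u)) n
    = fps_nth (fps_const (u / (4 * a)) * laguerre_fps (a + 1) u - fps_const (1 / 2) * laguerre_fps a u) n"
    by simp
  then show ?thesis
    by (simp add: algebra_simps)
qed

text \<open>The sign \<open>(-1) ^ k\<close> replaces \<open>t\<close> by \<open>- t\<close> in the
  first series, that is, it inverts the exponential and negates \<open>u\<close>. The exponentials
  cancel, and the product of two \<open>0F1\<close> series remains.\<close>

lemma laguerre_twisted_convolution:
  "(\<Sum>k\<le>m. (-1) ^ k * fps_nth (laguerre_fps a u) k * fps_nth (laguerre_fps b w) (m - k))
    = two_var_jacobi m a b u w / 4 ^ m"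
proof -
  have "(-1) ^ k * fps_nth (laguerre_fps a u) k = fps_nth (fps_exp (1 / 2) * bessel_fps a (- u)) k" for k
    unfolding laguerre_fps_def fps_mult_nth sum_distrib_left
  proof (rule sum.cong[OF refl])
    fix i assume "i \<in> {0..k}"
    then have s1: "(-1 :: real) ^ k = (-1) ^ i * (-1) ^ (k - i)"
      by (simp flip: power_add)
    have s2: "(1 / 2 :: real) ^ i = (-1) ^ i * (- 1 / 2) ^ i"
      and s3: "(- u / 4) ^ (k - i) = (-1) ^ (k - i) * (u / 4) ^ (k - i)"
      by (simp_all flip: power_mult_distrib)
    define d where "d = fact i * (fact (k - i) * pochhammer a (k - i))"
    have "(-1) ^ k * (fps_nth (fps_exp (- 1 / 2)) i * fps_nth (bessel_fps a u) (k - i))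
      = (-1) ^ k * (- 1 / 2) ^ i * (u / 4) ^ (k - i) / d"
      by (simp add: bessel_fps_def d_def)
    also have "(-1) ^ k * (- 1 / 2) ^ i * (u / 4) ^ (k - i) = (1 / 2) ^ i * (- u / 4) ^ (k - i)"
      unfolding s1 s2 s3 by (simp only: mult_ac)
    also have "\<dots> / d = fps_nth (fps_exp (1 / 2)) i * fps_nth (bessel_fps a (- u)) (k - i)"
      by (simp add: bessel_fps_def d_def)
    finally show "(-1) ^ k * (fps_nth (fps_exp (- 1 / 2)) i * fps_nth (bessel_fps a u) (k - i))
      = fps_nth (fps_exp (1 / 2)) i * fps_nth (bessel_fps a (- u)) (k - i)" .
  qed
  then have "(\<Sum>k\<le>m. (-1) ^ k * fps_nth (laguerre_fps a u) k * fps_nth (laguerre_fps b w) (m - k))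
    = fps_nth ((fps_exp (1 / 2) * bessel_fps a (- u)) * laguerre_fps b w) m"
    by (simp add: fps_mult_nth atMost_atLeast0)
  also have "(fps_exp (1 / 2) * bessel_fps a (- u)) * laguerre_fps b w
    = (fps_exp (1 / 2) * fps_exp (- 1 / 2)) * (bessel_fps a (- u) * bessel_fps b w)"
    by (simp add: laguerre_fps_def mult_ac)
  also have "fps_exp (1 / 2 :: real) * fps_exp (- 1 / 2) = 1"
    by (simp flip: fps_exp_add_mult)
  also have "fps_nth (1 * (bessel_fps a (- u) * bessel_fps b w)) m = two_var_jacobi m a b u w / 4 ^ m"
    unfolding mult_1 fps_mult_nth two_var_jacobi_def sum_divide_distrib atMost_atLeast0
  proof (rule sum.cong[OF refl])
    fix k assume "k \<in> {0..m}"
    then have "(4 :: real) ^ m = 4 ^ k * 4 ^ (m - k)"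
      by (simp flip: power_add)
    then show "fps_nth (bessel_fps a (- u)) k * fps_nth (bessel_fps b w) (m - k)
      = (- u) ^ k * w ^ (m - k) / (fact k * fact (m - k) * pochhammer a k * pochhammer b (m - k)) / 4 ^ m"
      unfolding bessel_fps_def fps_nth_Abs_fps power_divide by (simp add: mult_ac)
  qed
  finally show ?thesis .
qed

text \<open>The Chihara recurrence alternates between the two relations of the Laguerre
  coefficients: the step to odd degree is \<open>laguerre_fps_shift\<close>, the step to even degree
  is \<open>laguerre_fps_Suc\<close>. Both parities are proved in one induction.\<close>

lemma monic_chihara_laguerre:
  fixes x \<gamma> \<mu> :: real
  defines "u \<equiv> x\<^sup>2 - \<gamma>\<^sup>2"
  assumes "\<mu> > 0"
  shows "monic_chihara (2 * k) x \<mu> \<gamma> = mu_fact (2 * k) \<mu> * fps_nth (laguerre_fps (\<mu> + 1/2) u) k"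
    and "monic_chihara (Suc (2 * k)) x \<mu> \<gamma>
      = mu_fact (Suc (2 * k)) \<mu> * ((x - \<gamma>) / (2 * \<mu> + 1) * fps_nth (laguerre_fps (\<mu> + 3/2) u) k)"
proof -
  define A where "A = fps_nth (laguerre_fps (\<mu> + 1/2) u)"
  define B where "B = fps_nth (laguerre_fps (\<mu> + 3/2) u)"
  have pos: "\<mu> + 1/2 > 0" "2 * \<mu> + 1 > 0"
    using assms by auto
  have A: "(2 * \<mu> + 1) * A n = (2 * real n + 2 * \<mu> + 1) * B n + (if n = 0 then 0 else B (n - 1))" for n
    using laguerre_fps_shift[OF pos(1), of u n] by (simp add: A_def B_def algebra_simps)
  have B: "2 * real (Suc n) * A (Suc n) = u / (2 * \<mu> + 1) * B n - A n" for n
    using laguerre_fps_Suc[OF pos(1), of n u] by (simp add: A_def B_def algebra_simps)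
  have rec: "monic_chihara (Suc n) x \<mu> \<gamma> = (x - \<gamma> * (-1) ^ n) * monic_chihara n x \<mu> \<gamma>
      - mu_num n \<mu> * monic_chihara (n - 1) x \<mu> \<gamma>" for n
    using monic_chihara_recurrence[OF \<open>\<mu> > 0\<close>, of x n \<gamma>] by (simp add: algebra_simps)
  have num: "mu_num (Suc (2 * k)) \<mu> = 2 * real k + 2 * \<mu> + 1" "mu_num (Suc (Suc (2 * k))) \<mu> = 2 * real (Suc k)" for k
    by (simp_all add: mu_num_def)
  have odd: "monic_chihara (Suc (2 * k)) x \<mu> \<gamma> = mu_fact (Suc (2 * k)) \<mu> * ((x - \<gamma>) / (2 * \<mu> + 1) * B k)"
    if even: "monic_chihara (2 * k) x \<mu> \<gamma> = mu_fact (2 * k) \<mu> * A k"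
      and prev: "k > 0 \<Longrightarrow> monic_chihara (2 * k - 1) x \<mu> \<gamma> = mu_fact (2 * k - 1) \<mu> * ((x - \<gamma>) / (2 * \<mu> + 1) * B (k - 1))"
    for k
  proof -
    define X where "X = (x - \<gamma>) / (2 * \<mu> + 1)"
    have X: "x - \<gamma> = X * (2 * \<mu> + 1)"
      using pos(2) by (simp add: X_def)
    have "mu_num (2 * k) \<mu> * monic_chihara (2 * k - 1) x \<mu> \<gamma>
      = mu_fact (2 * k) \<mu> * X * (if k = 0 then 0 else B (k - 1))"
      using prev by (cases k) (simp_all add: mu_fact_Suc X_def)
    then have "monic_chihara (Suc (2 * k)) x \<mu> \<gamma>
      = (x - \<gamma>) * (mu_fact (2 * k) \<mu> * A k) - mu_fact (2 * k) \<mu> * X * (if k = 0 then 0 else B (k - 1))"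
      unfolding rec even by simp
    also have "\<dots> = mu_fact (2 * k) \<mu> * X * ((2 * \<mu> + 1) * A k - (if k = 0 then 0 else B (k - 1)))"
      unfolding X by (simp add: algebra_simps)
    finally have "monic_chihara (Suc (2 * k)) x \<mu> \<gamma>
      = mu_fact (2 * k) \<mu> * ((x - \<gamma>) / (2 * \<mu> + 1)) * ((2 * \<mu> + 1) * A k - (if k = 0 then 0 else B (k - 1)))"
      unfolding X_def .
    then show ?thesis
      unfolding A by (simp add: mu_fact_Suc num)
  qed
  have even: "monic_chihara (2 * Suc k) x \<mu> \<gamma> = mu_fact (2 * Suc k) \<mu> * A (Suc k)"
    if even: "monic_chihara (2 * k) x \<mu> \<gamma> = mu_fact (2 * k) \<mu> * A k"
      and odd: "monic_chihara (Suc (2 * k)) x \<mu> \<gamma> = mu_fact (Suc (2 * k)) \<mu> * ((x - \<gamma>) / (2 * \<mu> + 1) * B k)"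
    for k
  proof -
    have "monic_chihara (Suc (Suc (2 * k))) x \<mu> \<gamma>
      = mu_fact (Suc (2 * k)) \<mu> * ((x + \<gamma>) * ((x - \<gamma>) / (2 * \<mu> + 1) * B k) - A k)"
      unfolding rec[of "Suc (2 * k)"] odd diff_Suc_1 even by (simp add: mu_fact_Suc algebra_simps)
    \<comment> \<open>The alternating sign of \<gamma> makes consecutive steps combine to a
      difference of squares, the argument of the series.\<close>
    also have "(x + \<gamma>) * ((x - \<gamma>) / (2 * \<mu> + 1) * B k) = u / (2 * \<mu> + 1) * B k"
      by (simp add: u_def power2_eq_square algebra_simps)
    finally show ?thesis
      unfolding B[symmetric] by (simp add: mu_fact_Suc[of "Suc (2 * k)"] num)
  qed
  have "monic_chihara (2 * k) x \<mu> \<gamma> = mu_fact (2 * k) \<mu> * A k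
    \<and> monic_chihara (Suc (2 * k)) x \<mu> \<gamma> = mu_fact (Suc (2 * k)) \<mu> * ((x - \<gamma>) / (2 * \<mu> + 1) * B k)"
  proof (induction k)
    case 0
    have "A 0 = 1"
      by (simp add: A_def laguerre_fps_def bessel_fps_def)
    then show ?case
      using odd[of 0] by simp
  next
    case (Suc k)
    then show ?case
      using even[of k] odd[of "Suc k"] by simp
  qed
  then show "monic_chihara (2 * k) x \<mu> \<gamma> = mu_fact (2 * k) \<mu> * fps_nth (laguerre_fps (\<mu> + 1/2) u) k"
    and "monic_chihara (Suc (2 * k)) x \<mu> \<gamma>
      = mu_fact (Suc (2 * k)) \<mu> * ((x - \<gamma>) / (2 * \<mu> + 1) * fps_nth (laguerre_fps (\<mu> + 3/2) u) k)"
    by (simp_all add: A_def B_def)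
qed

section \<open>The pairing with the lowest weight vector\<close>

lemma sum_even_odd:
  fixes F :: "nat \<Rightarrow> real"
  shows "(\<Sum>n\<le>2 * m. F n) = (\<Sum>k\<le>m. F (2 * k)) + (\<Sum>k<m. F (Suc (2 * k)))"
    and "(\<Sum>n\<le>Suc (2 * m). F n) = (\<Sum>k\<le>m. F (2 * k)) + (\<Sum>k\<le>m. F (Suc (2 * k)))"
proof -
  show *: "(\<Sum>n\<le>2 * m. F n) = (\<Sum>k\<le>m. F (2 * k)) + (\<Sum>k<m. F (Suc (2 * k)))" for m
    by (induction m) simp_all
  show "(\<Sum>n\<le>Suc (2 * m). F n) = (\<Sum>k\<le>m. F (2 * k)) + (\<Sum>k\<le>m. F (Suc (2 * k)))"
    using *[of m] by (simp flip: lessThan_Suc_atMost)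
qed

text \<open>The exponent is \<open>2 * j * k + k * (2 * k - 1)\<close>, of the parity of
  \<open>k\<close>; this is the sign that twists the convolution.\<close>

lemma lowest_even:
  assumes "\<epsilon> \<in> {1, -1}"
  shows "2 * k + n = j \<Longrightarrow> lowest \<mu> \<nu> \<epsilon> j (2 * k) n = (-1) ^ k / (mu_fact (2 * k) \<mu> * mu_fact n \<nu>)"
proof -
  assume "2 * k + n = j"
  moreover have "\<epsilon> ^ (2 * k) = 1"
    using assms by (auto simp: power_mult)
  moreover have "(-1 :: real) ^ (j * (2 * k) + 2 * k * (2 * k - 1) div 2) = (-1) ^ k"
    by (cases k) (simp_all add: minus_one_power_iff)
  ultimately show "lowest \<mu> \<nu> \<epsilon> j (2 * k) n = (-1) ^ k / (mu_fact (2 * k) \<mu> * mu_fact n \<nu>)"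
    by (simp add: lowest_def)
qed

text \<open>The exponent \<open>(j + k) * (2 * k + 1)\<close> has the parity of
  \<open>j + k\<close>.\<close>

lemma lowest_odd:
  assumes "\<epsilon> \<in> {1, -1}"
  shows "Suc (2 * k) + n = j \<Longrightarrow> lowest \<mu> \<nu> \<epsilon> j (Suc (2 * k)) n
    = \<epsilon> * (-1) ^ j * (-1) ^ k / (mu_fact (Suc (2 * k)) \<mu> * mu_fact n \<nu>)"
proof -
  assume j: "Suc (2 * k) + n = j"
  have e1: "\<epsilon> ^ Suc (2 * k) = \<epsilon>"
    using assms by (auto simp: power_mult)
  have e2: "Suc (2 * k) * (Suc (2 * k) - 1) div 2 = Suc (2 * k) * k"
    by simp
  have e3: "(-1 :: real) ^ (j * Suc (2 * k) + Suc (2 * k) * k) = (-1) ^ j * (-1) ^ k"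
    by (simp add: minus_one_power_iff)
  show "lowest \<mu> \<nu> \<epsilon> j (Suc (2 * k)) n
    = \<epsilon> * (-1) ^ j * (-1) ^ k / (mu_fact (Suc (2 * k)) \<mu> * mu_fact n \<nu>)"
    unfolding lowest_def e1 e2 e3 if_P[OF j] by simp
qed

text \<open>Clears the prefactors that \<open>two_var_jacobi_eq\<close> leaves in the
  pairing.\<close>

lemma four_power_cancel:
  fixes d v t :: real
  assumes "d \<noteq> 0"
  shows "(- 4) ^ n * d * ((- v) ^ n / d * t / 4 ^ n) = v ^ n * t"
proof -
  have "A * d * (B / d * t / C) = A * B * t / C" for A B C :: real
    using assms by simp
  then have "(- 4) ^ n * d * ((- v) ^ n / d * t / 4 ^ n) = (- 4) ^ n * (- v) ^ n * t / 4 ^ n" .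
  also have "(- 4) ^ n * (- v) ^ n = 4 ^ n * v ^ n"
    unfolding power_mult_distrib[symmetric] by (simp only: minus_mult_minus)
  also have "4 ^ n * v ^ n * t / 4 ^ n = v ^ n * t"
    by simp
  finally show ?thesis .
qed

section \<open>Convolution of the Laguerre coefficients\<close>

context tensor_product
begin

context
  fixes \<delta> c x y :: real
  assumes delta: "\<delta> \<in> {1, -1}"
begin

abbreviation F where "F \<equiv> \<lambda>n. monic_chihara n x \<mu> (c * \<delta>)"
abbreviation G where "G \<equiv> \<lambda>n. monic_chihara n y \<nu> (x * \<epsilon>)"
abbreviation LF where "LF a \<equiv> fps_nth (laguerre_fps a (x\<^sup>2 - c\<^sup>2))"
abbreviation LG where "LG a \<equiv> fps_nth (laguerre_fps a (y\<^sup>2 - x\<^sup>2))"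

text \<open>The signs disappear on squaring, so the series arguments are \<open>x^2 - c^2\<close>
  and \<open>y^2 - x^2\<close>; their sum \<open>y^2 - c^2\<close> is free of
  \<open>x\<close>.\<close>

lemma delta_eps_square: "(c * \<delta>)\<^sup>2 = c\<^sup>2" "(x * \<epsilon>)\<^sup>2 = x\<^sup>2"
  using delta eps by (auto simp: power_mult_distrib)

lemmas F_laguerre = monic_chihara_laguerre[OF mu_pos, of _ x "c * \<delta>", unfolded delta_eps_square]
lemmas G_laguerre = monic_chihara_laguerre[OF nu_pos, of _ y "x * \<epsilon>", unfolded delta_eps_square]

lemma fact_nonzero: "mu_fact n \<mu> \<noteq> 0" "mu_fact n \<nu> \<noteq> 0"
  using mu_fact_pos[OF mu_pos] mu_fact_pos[OF nu_pos] by (auto simp: less_imp_neq[symmetric])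

text \<open>For even \<open>j\<close> the two degrees in a product have equal parity. The factorials
  in \<open>lowest\<close> cancel those of the Laguerre form, and even and odd indices each give a
  twisted convolution; for \<open>m = 0\<close> there is no odd index.\<close>

lemma pairing_lowest_even:
  assumes "j = 2 * m"
  shows "pairing F G j (lowest \<mu> \<nu> \<epsilon> j)
    = two_var_jacobi m (\<mu> + 1/2) (\<nu> + 1/2) (x\<^sup>2 - c\<^sup>2) (y\<^sup>2 - x\<^sup>2) / 4 ^ m
    + (if m = 0 then 0 else \<epsilon> * ((x - c * \<delta>) / (2 * \<mu> + 1)) * ((y - x * \<epsilon>) / (2 * \<nu> + 1))
        * two_var_jacobi (m - 1) (\<mu> + 3/2) (\<nu> + 3/2) (x\<^sup>2 - c\<^sup>2) (y\<^sup>2 - x\<^sup>2) / 4 ^ (m - 1))"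
proof -
  define X where "X = (x - c * \<delta>) / (2 * \<mu> + 1)"
  define Y where "Y = (y - x * \<epsilon>) / (2 * \<nu> + 1)"
  have 1: "lowest \<mu> \<nu> \<epsilon> j (2 * k) (j - 2 * k) * F (2 * k) * G (j - 2 * k)
     = (-1) ^ k * LF (\<mu> + 1/2) k * LG (\<nu> + 1/2) (m - k)" if "k \<le> m" for k
  proof -
    have n: "j - 2 * k = 2 * (m - k)"
      using assms by simp
    have "lowest \<mu> \<nu> \<epsilon> j (2 * k) (2 * (m - k)) = (-1) ^ k / (mu_fact (2 * k) \<mu> * mu_fact (2 * (m - k)) \<nu>)"
      by (rule lowest_even[OF eps]) (use assms that in simp)
    then show ?thesis
      unfolding n F_laguerre G_laguerre using fact_nonzero by simp
  qed
  have 2: "lowest \<mu> \<nu> \<epsilon> j (Suc (2 * k)) (j - Suc (2 * k)) * F (Suc (2 * k)) * G (j - Suc (2 * k))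
     = \<epsilon> * X * Y * ((-1) ^ k * LF (\<mu> + 3/2) k * LG (\<nu> + 3/2) (m - 1 - k))" if "k < m" for k
  proof -
    have n: "j - Suc (2 * k) = Suc (2 * (m - 1 - k))"
      using assms that by simp
    have "lowest \<mu> \<nu> \<epsilon> j (Suc (2 * k)) (Suc (2 * (m - 1 - k)))
      = \<epsilon> * (-1) ^ j * (-1) ^ k / (mu_fact (Suc (2 * k)) \<mu> * mu_fact (Suc (2 * (m - 1 - k))) \<nu>)"
      by (rule lowest_odd[OF eps]) (use assms that in simp)
    then show ?thesis
      unfolding n F_laguerre G_laguerre X_def[symmetric] Y_def[symmetric] using fact_nonzero assms by simp
  qed
  have "pairing F G j (lowest \<mu> \<nu> \<epsilon> j)
    = (\<Sum>k\<le>m. (-1) ^ k * LF (\<mu> + 1/2) k * LG (\<nu> + 1/2) (m - k))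
    + (\<Sum>k<m. \<epsilon> * X * Y * ((-1) ^ k * LF (\<mu> + 3/2) k * LG (\<nu> + 3/2) (m - 1 - k)))"
    unfolding pairing_def using 1 2 by (simp add: assms sum_even_odd)
  also have "(\<Sum>k<m. \<epsilon> * X * Y * ((-1) ^ k * LF (\<mu> + 3/2) k * LG (\<nu> + 3/2) (m - 1 - k)))
    = (if m = 0 then 0 else \<epsilon> * X * Y * two_var_jacobi (m - 1) (\<mu> + 3/2) (\<nu> + 3/2) (x\<^sup>2 - c\<^sup>2) (y\<^sup>2 - x\<^sup>2) / 4 ^ (m - 1))"
    unfolding sum_distrib_left[symmetric]
    by (cases m) (simp_all add: lessThan_Suc_atMost laguerre_twisted_convolution)
  finally show ?thesis
    unfolding laguerre_twisted_convolution X_def Y_def .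
qed

text \<open>For odd \<open>j\<close> the two degrees have opposite parity, and
  \<open>(-1) ^ j\<close> makes the contribution of the odd indices negative.\<close>

lemma pairing_lowest_odd:
  assumes "j = Suc (2 * m)"
  shows "pairing F G j (lowest \<mu> \<nu> \<epsilon> j)
    = (y - x * \<epsilon>) / (2 * \<nu> + 1) * two_var_jacobi m (\<mu> + 1/2) (\<nu> + 3/2) (x\<^sup>2 - c\<^sup>2) (y\<^sup>2 - x\<^sup>2) / 4 ^ m
    - \<epsilon> * ((x - c * \<delta>) / (2 * \<mu> + 1)) * two_var_jacobi m (\<mu> + 3/2) (\<nu> + 1/2) (x\<^sup>2 - c\<^sup>2) (y\<^sup>2 - x\<^sup>2) / 4 ^ m"
proof -
  define X where "X = (x - c * \<delta>) / (2 * \<mu> + 1)"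
  define Y where "Y = (y - x * \<epsilon>) / (2 * \<nu> + 1)"
  have 1: "lowest \<mu> \<nu> \<epsilon> j (2 * k) (j - 2 * k) * F (2 * k) * G (j - 2 * k)
     = Y * ((-1) ^ k * LF (\<mu> + 1/2) k * LG (\<nu> + 3/2) (m - k))" if "k \<le> m" for k
  proof -
    have n: "j - 2 * k = Suc (2 * (m - k))"
      using assms that by simp
    have "lowest \<mu> \<nu> \<epsilon> j (2 * k) (Suc (2 * (m - k))) = (-1) ^ k / (mu_fact (2 * k) \<mu> * mu_fact (Suc (2 * (m - k))) \<nu>)"
      by (rule lowest_even[OF eps]) (use assms that in simp)
    then show ?thesis
      unfolding n F_laguerre G_laguerre Y_def[symmetric] using fact_nonzero by simp
  qed
  have 2: "lowest \<mu> \<nu> \<epsilon> j (Suc (2 * k)) (j - Suc (2 * k)) * F (Suc (2 * k)) * G (j - Suc (2 * k))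
     = - \<epsilon> * X * ((-1) ^ k * LF (\<mu> + 3/2) k * LG (\<nu> + 1/2) (m - k))" if "k \<le> m" for k
  proof -
    have n: "j - Suc (2 * k) = 2 * (m - k)"
      using assms by simp
    have "lowest \<mu> \<nu> \<epsilon> j (Suc (2 * k)) (2 * (m - k))
      = \<epsilon> * (-1) ^ j * (-1) ^ k / (mu_fact (Suc (2 * k)) \<mu> * mu_fact (2 * (m - k)) \<nu>)"
      by (rule lowest_odd[OF eps]) (use assms that in simp)
    then show ?thesis
      unfolding n F_laguerre G_laguerre X_def[symmetric] using fact_nonzero assms by simp
  qed
  have "pairing F G j (lowest \<mu> \<nu> \<epsilon> j)
    = (\<Sum>k\<le>m. Y * ((-1) ^ k * LF (\<mu> + 1/2) k * LG (\<nu> + 3/2) (m - k)))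
    + (\<Sum>k\<le>m. - \<epsilon> * X * ((-1) ^ k * LF (\<mu> + 3/2) k * LG (\<nu> + 1/2) (m - k)))"
    unfolding pairing_def assms sum_even_odd(2) using 1 2 by (simp add: assms)
  then show ?thesis
    unfolding sum_distrib_left[symmetric] laguerre_twisted_convolution X_def Y_def by simp
qed

section \<open>Comparison with the big -1 Jacobi polynomials\<close>

lemma big_jacobi_argument:
  assumes "y\<^sup>2 - c\<^sup>2 \<noteq> 0" "y \<noteq> 0"
  shows "(1 - (\<epsilon> * x / y)\<^sup>2) / (1 - (- (c * \<delta> * \<epsilon>) / y)\<^sup>2) = (y\<^sup>2 - x\<^sup>2) / (y\<^sup>2 - c\<^sup>2)"
    and "(1 - \<epsilon> * x / y) / (1 + - (c * \<delta> * \<epsilon>) / y) = (y - x * \<epsilon>) / (y - c * \<delta> * \<epsilon>)"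
proof -
  have sq: "\<epsilon>\<^sup>2 = 1" "\<delta>\<^sup>2 = 1"
    using eps delta by auto
  have "1 - (\<epsilon> * x / y)\<^sup>2 = (y\<^sup>2 - x\<^sup>2) / y\<^sup>2" "1 - (- (c * \<delta> * \<epsilon>) / y)\<^sup>2 = (y\<^sup>2 - c\<^sup>2) / y\<^sup>2"
    using assms sq by (simp_all add: power_divide power_mult_distrib diff_divide_distrib)
  then show "(1 - (\<epsilon> * x / y)\<^sup>2) / (1 - (- (c * \<delta> * \<epsilon>) / y)\<^sup>2) = (y\<^sup>2 - x\<^sup>2) / (y\<^sup>2 - c\<^sup>2)"
    using assms by simp
  have "1 - \<epsilon> * x / y = (y - x * \<epsilon>) / y" "1 + - (c * \<delta> * \<epsilon>) / y = (y - c * \<delta> * \<epsilon>) / y"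
    using assms by (simp_all add: diff_divide_distrib mult.commute)
  then show "(1 - \<epsilon> * x / y) / (1 + - (c * \<delta> * \<epsilon>) / y) = (y - x * \<epsilon>) / (y - c * \<delta> * \<epsilon>)"
    using assms by simp
qed

lemma product_y_c: "(y - c * \<delta> * \<epsilon>) * (y + c * \<delta> * \<epsilon>) = y\<^sup>2 - c\<^sup>2"
  using eps delta by (auto simp: power2_eq_square algebra_simps)

abbreviation J where "J \<equiv> big_jacobi j (\<epsilon> * x / y) (2 * \<nu>) (2 * \<mu>) (- (c * \<delta> * \<epsilon>) / y)"

text \<open>Both sides are combinations of the sums \<open>P\<close> and \<open>Q\<close>:
  \<open>jacobi_sum_shift_upper\<close> reduces the first series of \<open>J\<close> to them, and
  the coefficients of \<open>Q\<close> agree by a factorization. The case \<open>j = 0\<close> is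
  separate because the second series of \<open>J\<close> does not terminate there.\<close>

lemma big_jacobi_even:
  assumes "j = 2 * m" "y\<^sup>2 - c\<^sup>2 \<noteq> 0" "y \<noteq> 0"
  shows "(- 4) ^ m * fact m * pochhammer (\<mu> + 1/2) m * pairing F G j (lowest \<mu> \<nu> \<epsilon> j) = (y\<^sup>2 - c\<^sup>2) ^ m * J"
proof (cases m)
  case 0
  then show ?thesis
    using pairing_lowest_even[OF assms(1)] assms(1) by (simp add: two_var_jacobi_def big_jacobi_0)
next
  case (Suc l)
  define a where "a = \<mu> + 1/2"
  define b where "b = \<nu> + 1/2"
  \<comment> \<open>The upper parameter in \<open>two_var_jacobi_eq\<close> for length
    \<open>l + 1\<close> and \<open>a\<close>, \<open>b\<close>; for length \<open>l\<close> and
    \<open>a + 1\<close>, \<open>b + 1\<close> it becomes \<open>p + 1\<close>.\<close>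
  define p where "p = real l + a + b"
  define v where "v = y\<^sup>2 - c\<^sup>2"
  define z where "z = (y\<^sup>2 - x\<^sup>2) / v"
  define P where "P = jacobi_sum (Suc l) p b z"
  define Q where "Q = jacobi_sum l (p + 1) (b + 1) z"
  have pos: "a > 0" "b > 0" "a + 1 > 0" "b + 1 > 0"
    using mu_pos nu_pos by (auto simp: a_def b_def)
  have v: "v = (x\<^sup>2 - c\<^sup>2) + (y\<^sup>2 - x\<^sup>2)" "v \<noteq> 0"
    using assms by (auto simp: v_def)
  have J: "J = jacobi_sum (Suc l) (p + 1) b z
      + real (Suc l) / b * ((y - x * \<epsilon>) / (y - c * \<delta> * \<epsilon>)) * Q"
  proof -
    have 1: "- real j / 2 = - real (Suc l)" "(real j + 2 * \<nu> + 2 * \<mu> + 2) / 2 = p + 1"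
      "(2 * \<nu> + 1) / 2 = b" "1 - real j / 2 = - real l" "(2 * \<nu> + 3) / 2 = b + 1"
      using assms(1) Suc by (simp_all add: p_def a_def b_def field_simps)
    have 2: "real j * (1 - \<epsilon> * x / y) / ((1 + - (c * \<delta> * \<epsilon>) / y) * (2 * \<nu> + 1))
       = real (Suc l) / b * ((1 - \<epsilon> * x / y) / (1 + - (c * \<delta> * \<epsilon>) / y))"
      using assms(1) Suc pos by (simp add: b_def field_simps)
    have ev: "even j" using assms by simp
    show ?thesis
      unfolding big_jacobi_def Let_def if_P[OF ev] big_jacobi_argument[OF assms(2,3)] 1 2 hyp2F1_terminating
      by (simp add: z_def v_def Q_def)
  qed
  have "pairing F G j (lowest \<mu> \<nu> \<epsilon> j)
    = two_var_jacobi (Suc l) a b (x\<^sup>2 - c\<^sup>2) (y\<^sup>2 - x\<^sup>2) / 4 ^ Suc l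
      + \<epsilon> * ((x - c * \<delta>) / (2 * a)) * ((y - x * \<epsilon>) / (2 * b))
        * two_var_jacobi l (a + 1) (b + 1) (x\<^sup>2 - c\<^sup>2) (y\<^sup>2 - x\<^sup>2) / 4 ^ l"
    unfolding pairing_lowest_even[OF assms(1)] Suc by (simp add: a_def b_def algebra_simps)
  also have "two_var_jacobi (Suc l) a b (x\<^sup>2 - c\<^sup>2) (y\<^sup>2 - x\<^sup>2)
      = (- v) ^ Suc l / (fact (Suc l) * pochhammer a (Suc l)) * P"
    using two_var_jacobi_eq[OF pos(1,2), of "x\<^sup>2 - c\<^sup>2" "y\<^sup>2 - x\<^sup>2" "Suc l"] v
    by (simp add: P_def p_def z_def add_ac)
  also have "two_var_jacobi l (a + 1) (b + 1) (x\<^sup>2 - c\<^sup>2) (y\<^sup>2 - x\<^sup>2)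
      = (- v) ^ l / (fact l * pochhammer (a + 1) l) * Q"
    using two_var_jacobi_eq[OF pos(3,4), of "x\<^sup>2 - c\<^sup>2" "y\<^sup>2 - x\<^sup>2" l] v
    by (simp add: Q_def p_def z_def add_ac)
  finally have "(- 4) ^ Suc l * fact (Suc l) * pochhammer a (Suc l) * pairing F G j (lowest \<mu> \<nu> \<epsilon> j)
      = (- 4) ^ Suc l * fact (Suc l) * pochhammer a (Suc l) * ((- v) ^ Suc l / (fact (Suc l) * pochhammer a (Suc l)) * P / 4 ^ Suc l)
      + (- 4) ^ Suc l * fact (Suc l) * pochhammer a (Suc l) * (\<epsilon> * ((x - c * \<delta>) / (2 * a)) * ((y - x * \<epsilon>) / (2 * b))
        * ((- v) ^ l / (fact l * pochhammer (a + 1) l) * Q) / 4 ^ l)"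
    by (simp only: distrib_left)
  also have "(- 4) ^ Suc l * fact (Suc l) * pochhammer a (Suc l) * ((- v) ^ Suc l / (fact (Suc l) * pochhammer a (Suc l)) * P / 4 ^ Suc l)
      = v ^ l * (v * P)"
  proof -
    have "fact (Suc l) * pochhammer a (Suc l) \<noteq> 0"
      using pochhammer_pos[OF pos(1), of "Suc l"] by simp
    from four_power_cancel[OF this, of "Suc l" v P] show ?thesis
      by (simp only: mult.assoc power_Suc2)
  qed
  also have "(- 4) ^ Suc l * fact (Suc l) * pochhammer a (Suc l) * (\<epsilon> * ((x - c * \<delta>) / (2 * a)) * ((y - x * \<epsilon>) / (2 * b))
        * ((- v) ^ l / (fact l * pochhammer (a + 1) l) * Q) / 4 ^ l)
      = v ^ l * (real (Suc l) / b * (- \<epsilon> * (x - c * \<delta>) * (y - x * \<epsilon>)) * Q)"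
  proof -
    have "fact l * pochhammer (a + 1) l \<noteq> 0"
      using pochhammer_pos[OF pos(3), of l] by simp
    note * = four_power_cancel[OF this, of l v Q]
    have lhs: "(- 4) ^ Suc l * fact (Suc l) * pochhammer a (Suc l) * (\<epsilon> * ((x - c * \<delta>) / (2 * a)) * ((y - x * \<epsilon>) / (2 * b))
        * ((- v) ^ l / (fact l * pochhammer (a + 1) l) * Q) / 4 ^ l)
      = (- 4 * real (Suc l) * a * \<epsilon> * ((x - c * \<delta>) / (2 * a)) * ((y - x * \<epsilon>) / (2 * b)))
        * ((- 4) ^ l * (fact l * pochhammer (a + 1) l) * ((- v) ^ l / (fact l * pochhammer (a + 1) l) * Q / 4 ^ l))"
      unfolding pochhammer_rec[of a] fact_Suc power_Suc by (simp only: divide_inverse mult_ac)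
    have coeff: "- 4 * real (Suc l) * a * \<epsilon> * ((x - c * \<delta>) / (2 * a)) * ((y - x * \<epsilon>) / (2 * b))
      = real (Suc l) / b * (- \<epsilon> * (x - c * \<delta>) * (y - x * \<epsilon>))"
      using pos by (simp add: divide_simps) (simp add: algebra_simps)
    show ?thesis
      unfolding lhs * coeff by (simp only: mult_ac)
  qed
  \<comment> \<open>Both sides are \<open>y - x * \<epsilon>\<close> times
    \<open>\<epsilon> * (c * \<delta> - x)\<close>, since \<open>v\<close> factors by
    \<open>product_y_c\<close> and \<open>v * z\<close> is the difference of squares
    \<open>y^2 - x^2\<close>.\<close>
  also have "- \<epsilon> * (x - c * \<delta>) * (y - x * \<epsilon>) = - (v * z) + v * ((y - x * \<epsilon>) / (y - c * \<delta> * \<epsilon>))"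
  proof -
    have "y - c * \<delta> * \<epsilon> \<noteq> 0"
      using product_y_c assms(2) by auto
    then have "v * ((y - x * \<epsilon>) / (y - c * \<delta> * \<epsilon>)) = (y + c * \<delta> * \<epsilon>) * (y - x * \<epsilon>)"
      unfolding v_def product_y_c[symmetric] by simp
    moreover have "v * z = y\<^sup>2 - x\<^sup>2"
      using v by (simp add: z_def)
    ultimately show ?thesis
      using eps by (auto simp: power2_eq_square algebra_simps)
  qed
  also have "v ^ l * (v * P) + v ^ l * (real (Suc l) / b * (- (v * z) + v * ((y - x * \<epsilon>) / (y - c * \<delta> * \<epsilon>))) * Q)
     = v ^ Suc l * J"
  proof -
    have "v ^ l * (v * P) + v ^ l * (n / b * (- (v * z) + v * w) * Q)
      = v ^ Suc l * (P - n * z / b * Q + n / b * w * Q)" for n w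
      by (simp add: algebra_simps)
    then show ?thesis
      unfolding J jacobi_sum_shift_upper[OF pos(2)] P_def[symmetric] Q_def[symmetric] .
  qed
  finally show ?thesis
    unfolding Suc a_def v_def .
qed

text \<open>Both convolutions have the upper parameter \<open>p\<close>, with lower parameters
  \<open>b + 1\<close> and \<open>b\<close>. The contiguous relation expresses the second series of
  \<open>J\<close>, where both parameters are raised, through these two.\<close>

lemma big_jacobi_odd:
  assumes "j = Suc (2 * m)" "y\<^sup>2 - c\<^sup>2 \<noteq> 0" "y \<noteq> 0"
  shows "- 2 * (- 4) ^ m * fact m * pochhammer (\<mu> + 1/2) (Suc m) * pairing F G j (lowest \<mu> \<nu> \<epsilon> j)
    = (y\<^sup>2 - c\<^sup>2) ^ m * (y - c * \<delta> * \<epsilon>) * J"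
proof -
  define a where "a = \<mu> + 1/2"
  define b where "b = \<nu> + 1/2"
  define p where "p = real m + a + b"
  define v where "v = y\<^sup>2 - c\<^sup>2"
  define z where "z = (y\<^sup>2 - x\<^sup>2) / v"
  define P where "P = jacobi_sum m p b z"
  define Q where "Q = jacobi_sum m p (b + 1) z"
  have pos: "a > 0" "b > 0" "a + 1 > 0" "b + 1 > 0"
    using mu_pos nu_pos by (auto simp: a_def b_def)
  have v: "v = (x\<^sup>2 - c\<^sup>2) + (y\<^sup>2 - x\<^sup>2)" "v \<noteq> 0"
    using assms by (auto simp: v_def)
  have yc: "y - c * \<delta> * \<epsilon> \<noteq> 0"
    using product_y_c assms(2) by auto
  have J: "J = P - (y - x * \<epsilon>) / (y - c * \<delta> * \<epsilon>) / b * (p * jacobi_sum m (p + 1) (b + 1) z)"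
  proof -
    have 1: "- (real j - 1) / 2 = - real m" "(real j + 2 * \<nu> + 2 * \<mu> + 1) / 2 = p"
      "(2 * \<nu> + 1) / 2 = b" "(real j + 2 * \<nu> + 2 * \<mu> + 3) / 2 = p + 1" "(2 * \<nu> + 3) / 2 = b + 1"
      using assms(1) by (simp_all add: p_def a_def b_def field_simps)
    have 2: "(real j + 2 * \<nu> + 2 * \<mu> + 1) * (1 - \<epsilon> * x / y) / ((1 + - (c * \<delta> * \<epsilon>) / y) * (2 * \<nu> + 1))
       = p / b * ((1 - \<epsilon> * x / y) / (1 + - (c * \<delta> * \<epsilon>) / y))"
    proof -
      have "real j + 2 * \<nu> + 2 * \<mu> + 1 = 2 * p" "2 * \<nu> + 1 = 2 * b"
        using assms(1) by (simp_all add: p_def a_def b_def)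
      then show ?thesis by simp
    qed
    have od: "\<not> even j" using assms by simp
    show ?thesis
      unfolding big_jacobi_def Let_def if_not_P[OF od] big_jacobi_argument[OF assms(2,3)] 2 unfolding 1 hyp2F1_terminating
      by (simp add: z_def v_def P_def mult_ac)
  qed
  have "pairing F G j (lowest \<mu> \<nu> \<epsilon> j)
    = (y - x * \<epsilon>) / (2 * b) * two_var_jacobi m a (b + 1) (x\<^sup>2 - c\<^sup>2) (y\<^sup>2 - x\<^sup>2) / 4 ^ m
      - \<epsilon> * ((x - c * \<delta>) / (2 * a)) * two_var_jacobi m (a + 1) b (x\<^sup>2 - c\<^sup>2) (y\<^sup>2 - x\<^sup>2) / 4 ^ m"
    unfolding pairing_lowest_odd[OF assms(1)] by (simp add: a_def b_def algebra_simps)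
  also have "two_var_jacobi m a (b + 1) (x\<^sup>2 - c\<^sup>2) (y\<^sup>2 - x\<^sup>2)
      = (- v) ^ m / (fact m * pochhammer a m) * Q"
    using two_var_jacobi_eq[OF pos(1,4), of "x\<^sup>2 - c\<^sup>2" "y\<^sup>2 - x\<^sup>2" m] v
    by (simp add: Q_def p_def z_def add_ac)
  also have "two_var_jacobi m (a + 1) b (x\<^sup>2 - c\<^sup>2) (y\<^sup>2 - x\<^sup>2)
      = (- v) ^ m / (fact m * pochhammer (a + 1) m) * P"
    using two_var_jacobi_eq[OF pos(3,2), of "x\<^sup>2 - c\<^sup>2" "y\<^sup>2 - x\<^sup>2" m] v
    by (simp add: P_def p_def z_def add_ac)
  finally have "- 2 * (- 4) ^ m * fact m * pochhammer a (Suc m) * pairing F G j (lowest \<mu> \<nu> \<epsilon> j)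
      = - 2 * (- 4) ^ m * fact m * pochhammer a (Suc m) * ((y - x * \<epsilon>) / (2 * b) * ((- v) ^ m / (fact m * pochhammer a m) * Q) / 4 ^ m)
      + 2 * (- 4) ^ m * fact m * pochhammer a (Suc m) * (\<epsilon> * ((x - c * \<delta>) / (2 * a)) * ((- v) ^ m / (fact m * pochhammer (a + 1) m) * P) / 4 ^ m)"
    by (simp only: right_diff_distrib)
  also have "- 2 * (- 4) ^ m * fact m * pochhammer a (Suc m) * ((y - x * \<epsilon>) / (2 * b) * ((- v) ^ m / (fact m * pochhammer a m) * Q) / 4 ^ m)
      = - (v ^ m * ((y - x * \<epsilon>) / b * ((p - b) * Q)))"
  proof -
    have "fact m * pochhammer a m \<noteq> 0"
      using pochhammer_pos[OF pos(1), of m] by simp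
    note * = four_power_cancel[OF this, of m v Q]
    have lhs: "- 2 * (- 4) ^ m * fact m * pochhammer a (Suc m) * ((y - x * \<epsilon>) / (2 * b) * ((- v) ^ m / (fact m * pochhammer a m) * Q) / 4 ^ m)
      = (- 2 * (a + real m) * ((y - x * \<epsilon>) / (2 * b)))
        * ((- 4) ^ m * (fact m * pochhammer a m) * ((- v) ^ m / (fact m * pochhammer a m) * Q / 4 ^ m))"
      unfolding pochhammer_Suc[of a] by (simp only: divide_inverse mult_ac)
    \<comment> \<open>Here \<open>p - b = a + m\<close>, the last factor of
      \<open>pochhammer a (Suc m)\<close>, which survives the cancellation.\<close>
    have coeff: "- 2 * (a + real m) * ((y - x * \<epsilon>) / (2 * b)) = - ((y - x * \<epsilon>) / b * (p - b))"
      using pos by (simp add: p_def divide_simps) (simp add: algebra_simps)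
    show ?thesis
      unfolding lhs * coeff by (simp only: mult_minus_left mult_minus_right mult_ac)
  qed
  also have "2 * (- 4) ^ m * fact m * pochhammer a (Suc m) * (\<epsilon> * ((x - c * \<delta>) / (2 * a)) * ((- v) ^ m / (fact m * pochhammer (a + 1) m) * P) / 4 ^ m)
      = v ^ m * (\<epsilon> * (x - c * \<delta>) * P)"
  proof -
    have "fact m * pochhammer (a + 1) m \<noteq> 0"
      using pochhammer_pos[OF pos(3), of m] by simp
    note * = four_power_cancel[OF this, of m v P]
    have "2 * (- 4) ^ m * fact m * pochhammer a (Suc m) * (\<epsilon> * ((x - c * \<delta>) / (2 * a)) * ((- v) ^ m / (fact m * pochhammer (a + 1) m) * P) / 4 ^ m)
      = (2 * a * (\<epsilon> * ((x - c * \<delta>) / (2 * a))))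
        * ((- 4) ^ m * (fact m * pochhammer (a + 1) m) * ((- v) ^ m / (fact m * pochhammer (a + 1) m) * P / 4 ^ m))"
      unfolding pochhammer_rec[of a] by simp
    then show ?thesis
      unfolding * using pos by simp
  qed
  \<comment> \<open>The first bracket yields the leading \<open>P\<close> of \<open>J\<close>; the
    second completes \<open>(p - b) * Q\<close> to the contiguous combination.\<close>
  also have "\<epsilon> * (x - c * \<delta>) = (y - c * \<delta> * \<epsilon>) - (y - x * \<epsilon>)"
    by (simp add: algebra_simps)
  also have "- (v ^ m * ((y - x * \<epsilon>) / b * ((p - b) * Q))) + v ^ m * (((y - c * \<delta> * \<epsilon>) - (y - x * \<epsilon>)) * P)
     = v ^ m * (y - c * \<delta> * \<epsilon>) * J"
    unfolding J jacobi_sum_contiguous[OF pos(2)] P_def[symmetric] Q_def[symmetric]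
    using pos yc by (simp add: field_simps)
  finally show ?thesis
    unfolding a_def v_def .
qed

end

end

section \<open>Normalization\<close>

lemma pochhammer_reflect:
  fixes b z :: real
  assumes "z = 1 - b - real k"
  shows "pochhammer z k = (-1) ^ k * pochhammer b k"
proof -
  have "z = - (b + real k - 1)"
    using assms by simp
  then show ?thesis
    using pochhammer_minus[of "b + real k - 1" k] by simp
qed

lemma pochhammer_reflect_nat:
  fixes z :: real
  assumes "z = - real (m + k)"
  shows "pochhammer z k = (-1) ^ k * (fact (m + k) / fact m)"
proof -
  have "fact (m + k) = (fact m * pochhammer (1 + real m) k :: real)"
    using pochhammer_product'[of "1 :: real" m k] by (simp add: pochhammer_fact)
  then show ?thesis
    using pochhammer_reflect[of z "1 + real m" k] assms by simp
qed

section \<open>Hahn weights and Gamma factors in Pochhammer symbols\<close>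

context tensor_product
begin

text \<open>The weight quotient at \<open>N = 0\<close> divided by \<open>mu_fact j \<nu>\<close>;
  \<open>j - j div 2\<close> is \<open>j / 2\<close> rounded up. The same constant stands under the
  root of \<open>jacobi_K\<close> and so links the two normalizations.\<close>

definition norm_const :: real where
  "norm_const = pochhammer (\<mu> + 1/2) (j - j div 2) / (2 ^ j * fact (j div 2)
    * pochhammer (\<nu> + 1/2) (j - j div 2) * pochhammer (\<mu> + \<nu> + 1 + real (j div 2)) (j - j div 2))"

lemma even_odd_halves:
  "even (2 * k)" "\<not> even (Suc (2 * k))" "2 * k div 2 = k" "(Suc (2 * k) - 1) div 2 = k" "(Suc (2 * k) + 1) div 2 = Suc k"
  for k :: nat
  by simp_all

text \<open>The names give the parity of the index, then that of \<open>M\<close>. For even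
  \<open>M\<close> the weight is taken at \<open>M\<close> minus the index, whose half rounded down
  is \<open>r\<close>; reflection makes all bases positive and the signs cancel.\<close>

lemma rho_nu_even_even:
  fixes m r :: nat
  defines "M \<equiv> 2 * (m + r)"
  shows "hahn_rho (2 * m) \<nu> \<mu> M / hahn_nu0 \<nu> \<mu> M
    = fact (m + r) * pochhammer (\<nu> + 1/2 + real m) r * pochhammer (\<mu> + \<nu> + real (2 * m + r) + 1) r
        * pochhammer (\<mu> + 1/2) (m + r)
      / (fact m * fact r * pochhammer (\<mu> + 1/2 + real m) r * pochhammer (\<mu> + \<nu> + real m + 1) r
        * pochhammer (\<mu> + \<nu> + real (m + r) + 1) (m + r))"
proof -
  have M: "even M" "M - 2 * m = 2 * r" "M div 2 = m + r"
    by (simp_all add: M_def)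
  have p: "pochhammer (- real M / 2) r = (-1) ^ r * (fact (m + r) / fact m)"
      "pochhammer (- real M / 2 - \<nu> + 1/2) r = (-1) ^ r * pochhammer (\<nu> + 1/2 + real m) r"
      "pochhammer (- real M - \<nu> - \<mu>) r = (-1) ^ r * pochhammer (\<mu> + \<nu> + real (2 * m + r) + 1) r"
      "pochhammer (- real M / 2 - \<mu> + 1/2) r = (-1) ^ r * pochhammer (\<mu> + 1/2 + real m) r"
      "pochhammer (- real M / 2 - \<nu> - \<mu>) r = (-1) ^ r * pochhammer (\<mu> + \<nu> + real m + 1) r"
      "pochhammer (- real M - \<nu> - \<mu>) (m + r) = (-1) ^ (m + r) * pochhammer (\<mu> + \<nu> + real (m + r) + 1) (m + r)"
      "pochhammer ((- real M - 2 * \<mu> + 1) / 2) (m + r) = (-1) ^ (m + r) * pochhammer (\<mu> + 1/2) (m + r)"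
    by (rule pochhammer_reflect_nat pochhammer_reflect, simp add: M_def field_simps)+
  show ?thesis
    unfolding hahn_rho_def hahn_varpi_def hahn_nu0_def
    by (simp only: M p even_odd_halves if_True if_False)
      (simp add: power_add minus_one_power_iff add.commute[of r m] del: fact_Suc pochhammer_Suc)
qed

lemma rho_nu_odd_even:
  fixes m r :: nat
  defines "M \<equiv> 2 * Suc (m + r)"
  shows "hahn_rho (Suc (2 * m)) \<nu> \<mu> M / hahn_nu0 \<nu> \<mu> M
    = fact (Suc (m + r)) * pochhammer (\<nu> + 1/2 + real (Suc m)) r * pochhammer (\<mu> + \<nu> + real (2 * m + r) + 3) r
        * pochhammer (\<mu> + 1/2) (Suc (m + r))
      / (fact m * fact r * pochhammer (\<mu> + 1/2 + real (Suc m)) r * pochhammer (\<mu> + \<nu> + real m + 1) (Suc r)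
        * pochhammer (\<mu> + \<nu> + real (m + r) + 2) (Suc (m + r)))"
proof -
  have M: "even M" "M - Suc (2 * m) = Suc (2 * r)" "M div 2 = Suc (m + r)"
    by (simp_all add: M_def)
  have p: "pochhammer (- real M / 2) (Suc r) = (-1) ^ Suc r * (fact (m + Suc r) / fact m)"
      "pochhammer (- real M / 2 - \<nu> + 1/2) r = (-1) ^ r * pochhammer (\<nu> + 1/2 + real (Suc m)) r"
      "pochhammer (- real M - \<nu> - \<mu>) r = (-1) ^ r * pochhammer (\<mu> + \<nu> + real (2 * m + r) + 3) r"
      "pochhammer (- real M / 2 - \<mu> + 1/2) r = (-1) ^ r * pochhammer (\<mu> + 1/2 + real (Suc m)) r"
      "pochhammer (- real M / 2 - \<nu> - \<mu>) (Suc r) = (-1) ^ Suc r * pochhammer (\<mu> + \<nu> + real m + 1) (Suc r)"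
      "pochhammer (- real M - \<nu> - \<mu>) (Suc (m + r)) = (-1) ^ Suc (m + r) * pochhammer (\<mu> + \<nu> + real (m + r) + 2) (Suc (m + r))"
      "pochhammer ((- real M - 2 * \<mu> + 1) / 2) (Suc (m + r)) = (-1) ^ Suc (m + r) * pochhammer (\<mu> + 1/2) (Suc (m + r))"
    by (rule pochhammer_reflect_nat pochhammer_reflect, simp add: M_def field_simps)+
  show ?thesis
    unfolding hahn_rho_def hahn_varpi_def hahn_nu0_def
    by (simp only: M p even_odd_halves if_True if_False)
      (simp add: power_add minus_one_power_iff add.commute[of r m] del: fact_Suc pochhammer_Suc)
qed

text \<open>For odd \<open>M\<close> the weight is taken at the index itself, and only the base
  \<open>(1 - M) / 2\<close> has to be reflected.\<close>

lemma rho_nu_even_odd: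
  fixes m r :: nat
  defines "M \<equiv> Suc (2 * (m + r))"
  shows "hahn_rho (2 * m) \<nu> \<mu> M / hahn_nu0 \<nu> \<mu> M
    = fact (m + r) * pochhammer (\<mu> + 1/2) m * pochhammer (\<mu> + \<nu> + 1) m * pochhammer (\<nu> + 1/2) (Suc (m + r))
      / (fact m * fact r * pochhammer (\<nu> + 1/2) m * pochhammer (\<mu> + \<nu> + real (m + r) + 2) m
        * pochhammer (\<mu> + \<nu> + 1) (Suc (m + r)))"
proof -
  have M: "odd M" "(M + 1) div 2 = Suc (m + r)"
    by (simp_all add: M_def)
  have p: "pochhammer ((1 - real M) / 2) m = (-1) ^ m * (fact (r + m) / fact r)"
      "(real M + 3) / 2 + \<nu> + \<mu> = \<mu> + \<nu> + real (m + r) + 2"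
      "\<nu> + \<mu> = \<mu> + \<nu>"
    by (rule pochhammer_reflect_nat, simp add: M_def)
      (simp_all add: M_def field_simps)
  show ?thesis
    unfolding hahn_rho_def hahn_varpi_def hahn_nu0_def
    by (simp only: M p even_odd_halves if_True if_False)
      (simp add: power_add minus_one_power_iff add.commute[of r m] del: fact_Suc pochhammer_Suc)
qed

lemma rho_nu_odd_odd:
  fixes m r :: nat
  defines "M \<equiv> Suc (2 * (m + r))"
  shows "hahn_rho (Suc (2 * m)) \<nu> \<mu> M / hahn_nu0 \<nu> \<mu> M
    = fact (m + r) * pochhammer (\<mu> + 1/2) (Suc m) * pochhammer (\<mu> + \<nu> + 1) m * pochhammer (\<nu> + 1/2) (Suc (m + r))
      / (fact m * fact r * pochhammer (\<nu> + 1/2) (Suc m) * pochhammer (\<mu> + \<nu> + real (m + r) + 2) m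
        * pochhammer (\<mu> + \<nu> + 1) (Suc (m + r)))"
proof -
  have M: "odd M" "(M + 1) div 2 = Suc (m + r)"
    by (simp_all add: M_def)
  have p: "pochhammer ((1 - real M) / 2) m = (-1) ^ m * (fact (r + m) / fact r)"
      "(real M + 3) / 2 + \<nu> + \<mu> = \<mu> + \<nu> + real (m + r) + 2"
      "\<nu> + \<mu> = \<mu> + \<nu>"
    by (rule pochhammer_reflect_nat, simp add: M_def)
      (simp_all add: M_def field_simps)
  show ?thesis
    unfolding hahn_rho_def hahn_varpi_def hahn_nu0_def
    by (simp only: M p even_odd_halves if_True if_False)
      (simp add: power_add minus_one_power_iff add.commute[of r m] del: fact_Suc pochhammer_Suc)
qed

text \<open>In each parity case the symbols based at \<open>a\<close> and \<open>b\<close> cancel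
  after splitting, and those based at \<open>e\<close> are one symbol cut in two ways. The result
  isolates how the weight quotient depends on \<open>N\<close>.\<close>

lemma rho_nu_normalization:
  "hahn_rho j \<nu> \<mu> (N + j) / hahn_nu0 \<nu> \<mu> (N + j) * mu_fact N \<kappa> = norm_const * mu_fact (N + j) \<nu>"
proof -
  define a where "a = \<mu> + 1/2"
  define b where "b = \<nu> + 1/2"
  define e where "e = \<mu> + \<nu> + 1"
  have pos: "a + real n > 0" "b + real n > 0" "e + real n > 0" for n
    using mu_pos nu_pos by (auto simp: a_def b_def e_def add_pos_nonneg)
  have nz: "pochhammer (a + real n) k \<noteq> 0" "pochhammer (b + real n) k \<noteq> 0" "pochhammer (e + real n) k \<noteq> 0" for n k
    using pos[of n] by (auto simp: less_imp_neq[symmetric] pochhammer_pos)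
  note nz0 = nz[of 0, simplified]
  have split: "pochhammer z (m + n) = pochhammer z m * pochhammer (z + real m) n" for z :: real and m n
    by (rule pochhammer_product')
  define m where "m = j div 2"
  define r where "r = N div 2"
  \<comment> \<open>Hence the symbols in \<open>mu_fact N \<kappa>\<close> continue those based at
    \<open>e\<close>.\<close>
  have kap: "\<kappa> + 1/2 = e + real j"
    by (simp add: \<kappa>_def e_def)
  consider "j = 2 * m" "N = 2 * r" | "j = Suc (2 * m)" "N = Suc (2 * r)"
    | "j = 2 * m" "N = Suc (2 * r)" | "j = Suc (2 * m)" "N = 2 * r"
    unfolding m_def r_def by (metis even_two_times_div_two odd_two_times_div_two_succ Suc_eq_plus1)
  then show ?thesis
  proof cases
    case 1
    have M: "N + j = 2 * (m + r)" using 1 by simp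
    have F: "mu_fact N \<kappa> = 4 ^ r * fact r * pochhammer (e + real (2 * m)) r"
      unfolding 1(2) mu_fact_even kap unfolding 1(1) ..
    have G: "mu_fact (N + j) \<nu> = 4 ^ (m + r) * fact (m + r) * pochhammer b (m + r)"
      unfolding M mu_fact_even b_def ..
    have C: "norm_const = pochhammer a m / (4 ^ m * fact m * pochhammer b m * pochhammer (e + real m) m)"
      unfolding norm_const_def unfolding 1(1) by (simp add: a_def b_def e_def power_mult add_ac)
    have args: "\<nu> + 1/2 + real m = b + real m" "\<mu> + \<nu> + real (2 * m + r) + 1 = e + real (m + (m + r))"
      "\<mu> + 1/2 + real m = a + real m" "\<mu> + \<nu> + real m + 1 = e + real m"
      "\<mu> + \<nu> + real (m + r) + 1 = e + real (m + r)" "\<mu> + 1/2 = a"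
      by (simp_all add: a_def b_def e_def)
    \<comment> \<open>Both sides are \<open>pochhammer (e + real m) (m + 2 * r)\<close>, cut as
      \<open>r + (m + r)\<close> and as \<open>m + r + r\<close>.\<close>
    have key: "pochhammer (e + real m) r * pochhammer (e + real (m + r)) (m + r)
      = pochhammer (e + real m) m * pochhammer (e + real (2 * m)) r * pochhammer (e + real (m + (m + r))) r"
    proof -
      have "pochhammer (e + real m) (r + (m + r)) = pochhammer (e + real m) r * pochhammer (e + real (m + r)) (m + r)"
        by (subst split) (simp add: add_ac)
      moreover have "pochhammer (e + real m) (m + (r + r))
        = pochhammer (e + real m) m * (pochhammer (e + real (2 * m)) r * pochhammer (e + real (m + (m + r))) r)"
        by (subst split, subst split) (simp add: add_ac)
      ultimately show ?thesis
        by (simp add: add_ac mult.assoc)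
    qed
    show ?thesis
      unfolding F C unfolding M unfolding 1(1) rho_nu_even_even args G[unfolded M]
      unfolding split[of a] split[of b] mult.assoc[of "fact m * fact r * pochhammer (a + real m) r"] key
      using nz nz0 by (simp add: power_add field_simps del: of_nat_add of_nat_mult)
  next
    case 2
    have M: "N + j = 2 * Suc (m + r)" using 2 by simp
    have F: "mu_fact N \<kappa> = 2 * 4 ^ r * fact r * pochhammer (e + real (Suc (2 * m))) (Suc r)"
      unfolding 2(2) mu_fact_odd kap unfolding 2(1) ..
    have G: "mu_fact (N + j) \<nu> = 4 ^ (Suc m + r) * fact (Suc (m + r)) * pochhammer b (Suc m + r)"
      unfolding M mu_fact_even b_def by simp
    have C: "norm_const = pochhammer a (Suc m) / (2 * 4 ^ m * fact m * pochhammer b (Suc m) * pochhammer (e + real m) (Suc m))"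
      unfolding norm_const_def unfolding 2(1) by (simp add: a_def b_def e_def power_mult add_ac Suc_diff_le del: pochhammer_Suc)
    have args: "\<nu> + 1/2 + real (Suc m) = b + real (Suc m)" "\<mu> + \<nu> + real (2 * m + r) + 3 = e + real (Suc m + (Suc m + r))"
      "\<mu> + 1/2 + real (Suc m) = a + real (Suc m)" "\<mu> + \<nu> + real m + 1 = e + real m"
      "\<mu> + \<nu> + real (m + r) + 2 = e + real (Suc m + r)" "\<mu> + 1/2 = a" "Suc (m + r) = Suc m + r"
      by (simp_all add: a_def b_def e_def)
    have key: "pochhammer (e + real m) (Suc r) * pochhammer (e + real (Suc m + r)) (Suc m + r)
      = pochhammer (e + real m) (Suc m) * pochhammer (e + real (Suc (2 * m))) (Suc r) * pochhammer (e + real (Suc m + (Suc m + r))) r"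
    proof -
      have "pochhammer (e + real m) (Suc r + (Suc m + r)) = pochhammer (e + real m) (Suc r) * pochhammer (e + real (Suc m + r)) (Suc m + r)"
        by (subst split) (simp add: add_ac del: pochhammer_Suc)
      moreover have "pochhammer (e + real m) (Suc m + (Suc r + r))
        = pochhammer (e + real m) (Suc m) * (pochhammer (e + real (Suc (2 * m))) (Suc r) * pochhammer (e + real (Suc m + (Suc m + r))) r)"
        by (subst split, subst split) (simp add: add_ac del: pochhammer_Suc)
      moreover have "Suc r + (Suc m + r) = Suc m + (Suc r + r)" by simp
      ultimately show ?thesis
        by (simp only: mult.assoc)
    qed
    show ?thesis
      unfolding F C unfolding M unfolding 2(1) rho_nu_odd_even G[unfolded M] unfolding args
      unfolding split[of a "Suc m"] split[of b "Suc m"] mult.assoc[of "fact m * fact r * pochhammer (a + real (Suc m)) r"] key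
      using nz nz0 by (simp add: power_add field_simps del: pochhammer_Suc fact_Suc of_nat_Suc of_nat_add of_nat_mult)
  next
    case 3
    have M: "N + j = Suc (2 * (m + r))" using 3 by simp
    have F: "mu_fact N \<kappa> = 2 * 4 ^ r * fact r * pochhammer (e + real (2 * m)) (Suc r)"
      unfolding 3(2) mu_fact_odd kap unfolding 3(1) ..
    have G: "mu_fact (N + j) \<nu> = 2 * 4 ^ (m + r) * fact (m + r) * pochhammer b (Suc (m + r))"
      unfolding M mu_fact_odd b_def ..
    have C: "norm_const = pochhammer a m / (4 ^ m * fact m * pochhammer b m * pochhammer (e + real m) m)"
      unfolding norm_const_def unfolding 3(1) by (simp add: a_def b_def e_def power_mult add_ac)
    have args: "\<mu> + 1/2 = a" "\<nu> + 1/2 = b" "\<mu> + \<nu> + 1 = e" "\<mu> + \<nu> + real (m + r) + 2 = e + real (Suc (m + r))"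
      by (simp_all add: a_def b_def e_def)
    \<comment> \<open>For odd grade both sides are
      \<open>pochhammer e (2 * m + r + 1)\<close>.\<close>
    have key: "pochhammer (e + real (Suc (m + r))) m * pochhammer e (Suc (m + r))
      = pochhammer e m * (pochhammer (e + real m) m * pochhammer (e + real (2 * m)) (Suc r))"
    proof -
      have "pochhammer e (Suc (m + r) + m) = pochhammer (e + real (Suc (m + r))) m * pochhammer e (Suc (m + r))"
        by (subst split) simp
      moreover have "pochhammer e (m + (m + Suc r))
        = pochhammer e m * (pochhammer (e + real m) m * pochhammer (e + real (2 * m)) (Suc r))"
        by (subst split, subst split) (simp add: add_ac del: pochhammer_Suc)
      moreover have "Suc (m + r) + m = m + (m + Suc r)" by simp
      ultimately show ?thesis
        by (simp only:)
    qed
    show ?thesis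
      unfolding F C unfolding M unfolding 3(1) rho_nu_even_odd G[unfolded M]
      unfolding args mult.assoc[of "fact m * fact r * pochhammer b m"] key
      using nz nz0 by (simp add: power_add field_simps del: pochhammer_Suc fact_Suc of_nat_Suc of_nat_add of_nat_mult)
  next
    case 4
    have M: "N + j = Suc (2 * (m + r))" using 4 by simp
    have F: "mu_fact N \<kappa> = 4 ^ r * fact r * pochhammer (e + real (Suc (2 * m))) r"
      unfolding 4(2) mu_fact_even kap unfolding 4(1) ..
    have G: "mu_fact (N + j) \<nu> = 2 * 4 ^ (m + r) * fact (m + r) * pochhammer b (Suc (m + r))"
      unfolding M mu_fact_odd b_def ..
    have C: "norm_const = pochhammer a (Suc m) / (2 * 4 ^ m * fact m * pochhammer b (Suc m) * pochhammer (e + real m) (Suc m))"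
      unfolding norm_const_def unfolding 4(1) by (simp add: a_def b_def e_def power_mult add_ac Suc_diff_le del: pochhammer_Suc)
    have args: "\<mu> + 1/2 = a" "\<nu> + 1/2 = b" "\<mu> + \<nu> + 1 = e" "\<mu> + \<nu> + real (m + r) + 2 = e + real (Suc (m + r))"
      by (simp_all add: a_def b_def e_def)
    have key: "pochhammer (e + real (Suc (m + r))) m * pochhammer e (Suc (m + r))
      = pochhammer e m * (pochhammer (e + real m) (Suc m) * pochhammer (e + real (Suc (2 * m))) r)"
    proof -
      have "pochhammer e (Suc (m + r) + m) = pochhammer (e + real (Suc (m + r))) m * pochhammer e (Suc (m + r))"
        by (subst split) simp
      moreover have "pochhammer e (m + (Suc m + r))
        = pochhammer e m * (pochhammer (e + real m) (Suc m) * pochhammer (e + real (Suc (2 * m))) r)"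
        by (subst split, subst split) (simp add: add_ac del: pochhammer_Suc)
      moreover have "Suc (m + r) + m = m + (Suc m + r)" by simp
      ultimately show ?thesis
        by (simp only:)
    qed
    show ?thesis
      unfolding F C unfolding M unfolding 4(1) rho_nu_odd_odd G[unfolded M]
      unfolding args mult.assoc[of "fact m * fact r * pochhammer b (Suc m)"] key
      using nz nz0 by (simp add: power_add field_simps del: pochhammer_Suc fact_Suc of_nat_Suc of_nat_add of_nat_mult)
  qed
qed

text \<open>All Gamma values lie at integer shifts of \<open>a\<close>, \<open>b\<close> and
  \<open>e + m\<close>, so they are Pochhammer symbols times three base values, which cancel.
  Besides \<open>norm_const\<close> there remain a square and \<open>2 ^ j\<close>, which meets the
  \<open>j\<close>-th power of 1/2 in \<open>jacobi_K\<close>.\<close>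

lemma Gamma_ratio_eq_norm_const:
  "Gamma (\<mu> + 1/2) * Gamma (\<nu> + 1/2) / (Gamma (\<mu> + \<nu> + real j + 1) * jacobi_h j (2 * \<nu>) (2 * \<mu>))
    = 2 ^ j * norm_const * (pochhammer (\<nu> + 1/2) (j - j div 2) / pochhammer (\<mu> + 1/2) (j - j div 2))\<^sup>2"
proof -
  define a where "a = \<mu> + 1/2"
  define b where "b = \<nu> + 1/2"
  define e where "e = \<mu> + \<nu> + 1"
  have pos: "a > 0" "b > 0" "e > 0"
    using mu_pos nu_pos by (auto simp: a_def b_def e_def)
  have shift: "Gamma (z + real n) = pochhammer z n * Gamma z" if "z > 0" for z n
  proof -
    have "z \<notin> \<int>\<^sub>\<le>\<^sub>0"
      using that by (auto simp: nonpos_Ints_def)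
    moreover have "Gamma z \<noteq> 0"
      using Gamma_real_pos[OF that] by simp
    ultimately show ?thesis
      by (simp add: pochhammer_Gamma)
  qed
  define m where "m = j div 2"
  have G: "Gamma a > 0" "Gamma b > 0" "Gamma (e + real m) > 0"
    using pos by (auto intro!: Gamma_real_pos)
  have p: "pochhammer a n > 0" "pochhammer b n > 0" "pochhammer (e + real m) n > 0" for n
    using pos by (auto intro!: pochhammer_pos add_pos_nonneg)
  consider "j = 2 * m" | "j = Suc (2 * m)"
    unfolding m_def by (metis even_two_times_div_two odd_two_times_div_two_succ Suc_eq_plus1)
  then show ?thesis
  proof cases
    case 1
    have args: "(real (2 * m) + 2 * \<mu> + 1) / 2 = a + real m" "(real (2 * m) + 2 * \<nu> + 3) / 2 = b + real (Suc m)"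
      "real (2 * m) + 2 * \<nu> + 1 = 2 * (b + real m)" "(real (2 * m) + 2 * \<nu> + 2 * \<mu> + 2) / 2 = e + real m"
      "(2 * \<nu> + 1) / 2 = b" "\<mu> + \<nu> + real (2 * m) + 1 = (e + real m) + real m"
      by (simp_all add: a_def b_def e_def field_simps)
    have h: "jacobi_h (2 * m) (2 * \<nu>) (2 * \<mu>)
      = pochhammer a m * Gamma a * pochhammer b m * Gamma b * fact m / (Gamma (e + real m) * (pochhammer b m)\<^sup>2)"
    proof -
      have "b + real m > 0"
        using pos by simp
      then show ?thesis
        unfolding jacobi_h_def args using pos
        by (simp add: args shift[of a] shift[of b "Suc m"] pochhammer_Suc[of b] del: of_nat_Suc distrib_left_numeral)
    qed
    have s: "Gamma (e + real m + real m) = pochhammer (e + real m) m * Gamma (e + real m)"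
      using pos by (intro shift) simp
    have C: "norm_const = pochhammer a m / (4 ^ m * fact m * pochhammer b m * pochhammer (e + real m) m)"
      unfolding norm_const_def unfolding 1 by (simp add: a_def b_def e_def power_mult add_ac)
    have pw: "(2 :: real) ^ (2 * m) = 4 ^ m"
      by (simp add: power_mult)
    show ?thesis
      unfolding C unfolding 1 h args s pw a_def[symmetric] b_def[symmetric]
      using G p[of m] by (simp add: field_simps power2_eq_square)
  next
    case 2
    have args: "(real (Suc (2 * m)) + 2 * \<mu> + 2) / 2 = a + real (Suc m)" "(real (Suc (2 * m)) + 2 * \<nu> + 2) / 2 = b + real (Suc m)"
      "real (Suc (2 * m)) + 2 * \<nu> + 2 * \<mu> + 1 = 2 * (e + real m)" "(real (Suc (2 * m)) + 2 * \<nu> + 2 * \<mu> + 3) / 2 = (e + real m) + real (Suc 0)"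
      "(2 * \<nu> + 1) / 2 = b" "\<mu> + \<nu> + real (Suc (2 * m)) + 1 = (e + real m) + real (Suc m)"
      by (simp_all add: a_def b_def e_def field_simps)
    have em: "e + real m > 0"
      using pos by simp
    have h: "jacobi_h (Suc (2 * m)) (2 * \<nu>) (2 * \<mu>)
      = pochhammer a (Suc m) * Gamma a * pochhammer b (Suc m) * Gamma b * fact m / (Gamma (e + real m) * (pochhammer b (Suc m))\<^sup>2)"
      unfolding jacobi_h_def args shift[OF pos(1)] shift[OF pos(2)] shift[OF em] using em
      by (simp add: args del: pochhammer_Suc distrib_left_numeral)
    have C: "norm_const = pochhammer a (Suc m) / (2 * 4 ^ m * fact m * pochhammer b (Suc m) * pochhammer (e + real m) (Suc m))"
      unfolding norm_const_def unfolding 2 by (simp add: a_def b_def e_def power_mult add_ac Suc_diff_le del: pochhammer_Suc)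
    have half: "Suc (2 * m) - Suc (2 * m) div 2 = Suc m" by simp
    have pw: "(2 :: real) ^ Suc (2 * m) = 2 * 4 ^ m"
      by (simp add: power_mult)
    show ?thesis
      unfolding C unfolding 2 h args shift[OF em] pw a_def[symmetric] b_def[symmetric] half
      using G p[of "Suc m"] by (simp add: field_simps power2_eq_square del: pochhammer_Suc)
  qed
qed

section \<open>The factor K and its sign\<close>

context
  fixes \<delta> c y :: real
  assumes delta: "\<delta> \<in> {1, -1}" and y_gt: "\<bar>y\<bar> > \<bar>c\<bar>"
begin

lemma abs_c_sign: "\<bar>c * \<delta> * \<epsilon>\<bar> = \<bar>c\<bar>"
  using delta eps by auto

lemma sgn_mult_abs_diff: "sgn y * \<bar>y - c * \<delta> * \<epsilon>\<bar> = y - c * \<delta> * \<epsilon>"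
proof -
  have "sgn y * \<bar>y - k\<bar> = y - k" if "\<bar>k\<bar> < \<bar>y\<bar>" for k
    using that by (auto simp: sgn_real_def abs_if split: if_splits)
  then show ?thesis
    using abs_c_sign y_gt by simp
qed

text \<open>The radicand is a perfect square times \<open>norm_const\<close>. For odd
  \<open>j\<close> the root yields \<open>\<bar>y - c * \<delta> * \<epsilon>\<bar>\<close>; since
  \<open>y\<close> dominates \<open>c\<close>, the factor \<open>sgn y\<close> turns it back into
  the difference.\<close>

lemma sgn_power_jacobi_K:
  "sgn y ^ j * jacobi_K j (\<delta> * \<epsilon>) y \<nu> \<mu> c
    = (y\<^sup>2 - c\<^sup>2) ^ (j div 2) * (if even j then 1 else y - c * \<delta> * \<epsilon>)
      * (pochhammer (\<nu> + 1/2) (j - j div 2) / pochhammer (\<mu> + 1/2) (j - j div 2)) * sqrt norm_const"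
proof -
  define v where "v = y\<^sup>2 - c\<^sup>2"
  define t where "t = pochhammer (\<nu> + 1/2) (j - j div 2) / pochhammer (\<mu> + 1/2) (j - j div 2)"
  define m where "m = j div 2"
  have v: "v > 0"
    using y_gt by (simp add: v_def flip: abs_le_square_iff not_le)
  have t: "t > 0"
    using mu_pos nu_pos by (auto simp: t_def intro!: divide_pos_pos pochhammer_pos)
  have prod: "(y - c * \<delta> * \<epsilon>) * (y + c * \<delta> * \<epsilon>) = v"
    using delta eps by (auto simp: v_def power2_eq_square algebra_simps)
  have nz: "y - c * \<delta> * \<epsilon> \<noteq> 0" "y + c * \<delta> * \<epsilon> \<noteq> 0" "y \<noteq> 0"
    using prod v y_gt by auto
  have K: "jacobi_K j (\<delta> * \<epsilon>) y \<nu> \<mu> c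
    = sqrt ((v / 2) ^ j * ((y - c * \<delta> * \<epsilon>) / (y - (-1) ^ j * (c * \<delta> * \<epsilon>))) * (2 ^ j * norm_const * t\<^sup>2))"
    unfolding jacobi_K_def Gamma_ratio_eq_norm_const v_def t_def by (simp only: mult.assoc)
  have vj: "(v / 2) ^ j * 2 ^ j = v ^ j"
    by (simp add: power_divide)
  show ?thesis
  proof (cases "even j")
    case True
    then have j: "j = 2 * m"
      by (simp add: m_def)
    have "(v / 2) ^ j * ((y - c * \<delta> * \<epsilon>) / (y - (-1) ^ j * (c * \<delta> * \<epsilon>))) * (2 ^ j * norm_const * t\<^sup>2)
      = ((v / 2) ^ j * 2 ^ j) * norm_const * t\<^sup>2"
      using True nz by simp
    also have "\<dots> = (v ^ m * t)\<^sup>2 * norm_const"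
    proof -
      have "v ^ j = (v ^ m)\<^sup>2"
        unfolding j by (simp add: power_mult mult.commute)
      then show ?thesis
        unfolding vj by (simp add: power_mult_distrib)
    qed
    finally have "jacobi_K j (\<delta> * \<epsilon>) y \<nu> \<mu> c = v ^ m * t * sqrt norm_const"
      unfolding K using v t by (simp add: real_sqrt_mult)
    moreover have "sgn y ^ j = 1"
      using nz unfolding j by (simp add: power_mult sgn_real_def)
    ultimately show ?thesis
      using True by (simp add: v_def t_def m_def)
  next
    case False
    then have j: "j = Suc (2 * m)"
      by (simp add: m_def)
    \<comment> \<open>For odd \<open>j\<close> one factor \<open>v\<close> is left over; with the
      quotient it forms a square.\<close>
    have quot: "v * ((y - c * \<delta> * \<epsilon>) / (y + c * \<delta> * \<epsilon>)) = (y - c * \<delta> * \<epsilon>)\<^sup>2"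
      using nz unfolding prod[symmetric] by (simp add: power2_eq_square)
    have "(v / 2) ^ j * ((y - c * \<delta> * \<epsilon>) / (y - (-1) ^ j * (c * \<delta> * \<epsilon>))) * (2 ^ j * norm_const * t\<^sup>2)
      = ((v / 2) ^ j * 2 ^ j) * ((y - c * \<delta> * \<epsilon>) / (y + c * \<delta> * \<epsilon>)) * norm_const * t\<^sup>2"
      using False by simp
    also have "\<dots> = (v ^ m)\<^sup>2 * (v * ((y - c * \<delta> * \<epsilon>) / (y + c * \<delta> * \<epsilon>))) * norm_const * t\<^sup>2"
    proof -
      have "v ^ j = (v ^ m)\<^sup>2 * v"
        unfolding j by (simp add: power_mult mult.commute)
      then show ?thesis
        unfolding vj by simp
    qed
    also have "\<dots> = (v ^ m * (y - c * \<delta> * \<epsilon>) * t)\<^sup>2 * norm_const"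
      unfolding quot by (simp add: power_mult_distrib)
    finally have "jacobi_K j (\<delta> * \<epsilon>) y \<nu> \<mu> c = v ^ m * \<bar>y - c * \<delta> * \<epsilon>\<bar> * t * sqrt norm_const"
      unfolding K using v t by (simp add: real_sqrt_mult abs_mult)
    moreover have "sgn y ^ j = sgn y"
      using nz unfolding j by (simp add: power_mult sgn_real_def)
    ultimately have "sgn y ^ j * jacobi_K j (\<delta> * \<epsilon>) y \<nu> \<mu> c
       = v ^ m * (sgn y * \<bar>y - c * \<delta> * \<epsilon>\<bar>) * t * sqrt norm_const"
      by (simp only: mult_ac)
    then show ?thesis
      unfolding sgn_mult_abs_diff using False by (simp add: v_def t_def m_def)
  qed
qed

text \<open>The prefactors of the pairing, times the quotient of symbols in K, give
  \<open>mu_fact j \<nu>\<close> up to sign. The sign is \<open>(-1) ^ m\<close> for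
  \<open>j = 2 * m\<close> and the opposite for \<open>j = 2 * m + 1\<close>; this is the origin of
  \<open>j * (j + 1) div 2\<close> in the phase.\<close>

lemma jacobi_K_times_big_jacobi:
  fixes x :: real
  defines "f \<equiv> \<lambda>n. monic_chihara n x \<mu> (c * \<delta>)" and "g \<equiv> \<lambda>n. monic_chihara n y \<nu> (x * \<epsilon>)"
  shows "sgn y ^ j * jacobi_K j (\<delta> * \<epsilon>) y \<nu> \<mu> c
      * big_jacobi j (\<epsilon> * x / y) (2 * \<nu>) (2 * \<mu>) (- (c * \<delta> * \<epsilon>) / y)
    = (-1) ^ (j * (j + 1) div 2) * sqrt norm_const * mu_fact j \<nu> * pairing f g j (lowest \<mu> \<nu> \<epsilon> j)"
proof -
  define m where "m = j div 2"
  have nz: "y\<^sup>2 - c\<^sup>2 \<noteq> 0" "y \<noteq> 0"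
    using y_gt by (auto simp: power2_eq_iff)
  have pos: "pochhammer (\<mu> + 1/2) k \<noteq> 0" for k
    using pochhammer_pos[of "\<mu> + 1/2" k] mu_pos by simp
  show ?thesis
  proof (cases "even j")
    case True
    then have j: "j = 2 * m"
      by (simp add: m_def)
    have half: "j div 2 = m" "j - m = m"
      using j by auto
    have sgn: "(-1 :: real) ^ (j * (j + 1) div 2) = (-1) ^ m"
      unfolding j by (simp add: minus_one_power_iff)
    have four: "(- 4 :: real) ^ m = (-1) ^ m * 4 ^ m"
      by (rule power_minus)
    define S where "S = pairing f g j (lowest \<mu> \<nu> \<epsilon> j)"
    have key: "(y\<^sup>2 - c\<^sup>2) ^ m * big_jacobi j (\<epsilon> * x / y) (2 * \<nu>) (2 * \<mu>) (- (c * \<delta> * \<epsilon>) / y)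
        = (-1) ^ m * 4 ^ m * fact m * pochhammer (\<mu> + 1/2) m * S"
      using big_jacobi_even[OF delta j nz, of x] unfolding S_def f_def g_def four by (rule sym)
    have "sgn y ^ j * jacobi_K j (\<delta> * \<epsilon>) y \<nu> \<mu> c
        * big_jacobi j (\<epsilon> * x / y) (2 * \<nu>) (2 * \<mu>) (- (c * \<delta> * \<epsilon>) / y)
      = pochhammer (\<nu> + 1/2) m / pochhammer (\<mu> + 1/2) m * sqrt norm_const
        * ((y\<^sup>2 - c\<^sup>2) ^ m * big_jacobi j (\<epsilon> * x / y) (2 * \<nu>) (2 * \<mu>) (- (c * \<delta> * \<epsilon>) / y))"
      unfolding sgn_power_jacobi_K half if_P[OF True] by (simp only: mult_1_right mult_ac)
    also have "\<dots> = (-1) ^ m * sqrt norm_const * mu_fact (2 * m) \<nu> * S"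
      unfolding key mu_fact_even using pos[of m] by simp
    finally show ?thesis
      unfolding sgn S_def by (simp flip: j)
  next
    case False
    then have j: "j = Suc (2 * m)"
      by (simp add: m_def)
    have half: "j div 2 = m" "j - m = Suc m"
      using j by auto
    have sgn: "(-1 :: real) ^ (j * (j + 1) div 2) = - ((-1) ^ m)"
    proof -
      have "j * (j + 1) div 2 = Suc (2 * m) * Suc m"
        unfolding j by simp
      then show ?thesis
        by (simp only:) (simp add: minus_one_power_iff)
    qed
    have four: "(- 4 :: real) ^ m = (-1) ^ m * 4 ^ m"
      by (rule power_minus)
    define S where "S = pairing f g j (lowest \<mu> \<nu> \<epsilon> j)"
    have key: "(y\<^sup>2 - c\<^sup>2) ^ m * (y - c * \<delta> * \<epsilon>) * big_jacobi j (\<epsilon> * x / y) (2 * \<nu>) (2 * \<mu>) (- (c * \<delta> * \<epsilon>) / y)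
        = - 2 * ((-1) ^ m * 4 ^ m) * fact m * pochhammer (\<mu> + 1/2) (Suc m) * S"
      using big_jacobi_odd[OF delta j nz, of x] unfolding S_def f_def g_def four by (rule sym)
    have "sgn y ^ j * jacobi_K j (\<delta> * \<epsilon>) y \<nu> \<mu> c
        * big_jacobi j (\<epsilon> * x / y) (2 * \<nu>) (2 * \<mu>) (- (c * \<delta> * \<epsilon>) / y)
      = pochhammer (\<nu> + 1/2) (Suc m) / pochhammer (\<mu> + 1/2) (Suc m) * sqrt norm_const
        * ((y\<^sup>2 - c\<^sup>2) ^ m * (y - c * \<delta> * \<epsilon>) * big_jacobi j (\<epsilon> * x / y) (2 * \<nu>) (2 * \<mu>) (- (c * \<delta> * \<epsilon>) / y))"
      unfolding sgn_power_jacobi_K half if_not_P[OF False] by (simp only: mult_ac)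
    also have "\<dots> = - ((-1) ^ m) * sqrt norm_const * mu_fact (Suc (2 * m)) \<nu> * S"
      unfolding key mu_fact_odd using pos[of "Suc m"] by (simp del: pochhammer_Suc)
    finally show ?thesis
      unfolding sgn S_def by (simp flip: j)
  qed
qed

end

section \<open>The addition formula\<close>

lemma kappa_pos: "\<kappa> > 0"
  using mu_pos nu_pos by (simp add: \<kappa>_def)

text \<open>The weight quotient depends on the grade only, so by \<open>rho_nu_normalization\<close>
  the index \<open>n\<close> survives in two factorials alone.\<close>

lemma sqrt_rho_nu:
  assumes "n \<le> N + j"
  shows "sqrt (mu_fact (N + j - n) \<nu> * hahn_rho j \<nu> \<mu> (N + j)
      / (mu_fact n \<mu> * mu_fact (N + j) \<nu> * hahn_nu0 \<nu> \<mu> (N + j)))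
    = sqrt norm_const / sqrt (mu_fact N \<kappa>) * sqrt (mu_fact (N + j - n) \<nu>) / sqrt (mu_fact n \<mu>)"
proof -
  have pos: "mu_fact k \<mu> > 0" "mu_fact k \<nu> > 0" "mu_fact k \<kappa> > 0" for k
    using mu_pos nu_pos kappa_pos by (auto intro: mu_fact_pos)
  have "hahn_rho j \<nu> \<mu> (N + j) / hahn_nu0 \<nu> \<mu> (N + j) = norm_const * mu_fact (N + j) \<nu> / mu_fact N \<kappa>"
    using rho_nu_normalization[of N] pos(3)[of N] by (simp add: field_simps)
  then have "mu_fact (N + j - n) \<nu> * hahn_rho j \<nu> \<mu> (N + j)
      / (mu_fact n \<mu> * mu_fact (N + j) \<nu> * hahn_nu0 \<nu> \<mu> (N + j))
    = mu_fact (N + j - n) \<nu> / (mu_fact n \<mu> * mu_fact (N + j) \<nu>) * (norm_const * mu_fact (N + j) \<nu> / mu_fact N \<kappa>)"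
    by (metis (no_types) times_divide_times_eq)
  also have "\<dots> = norm_const / mu_fact N \<kappa> * mu_fact (N + j - n) \<nu> / mu_fact n \<mu>"
    using pos(2)[of "N + j"] by (simp add: mult_ac)
  finally show ?thesis
    by (simp add: real_sqrt_mult real_sqrt_divide)
qed

text \<open>Read from the right: up to a constant the sum is the pairing with
  \<open>raised N\<close>, \<open>pairing_raised\<close> extracts the Chihara polynomial in
  \<kappa>, and the pairing with the lowest weight vector is the Jacobi factor.\<close>

lemma addition_formula:
  fixes \<delta> c x y :: real
  assumes "\<delta> \<in> {1, -1}" "\<bar>y\<bar> > \<bar>c\<bar>"
  shows "sgn y ^ j * jacobi_K j (\<delta> * \<epsilon>) y \<nu> \<mu> c * chihara N y \<kappa> (c * (\<delta> * \<epsilon> * (-1) ^ j))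
      * big_jacobi j (\<epsilon> * x / y) (2 * \<nu>) (2 * \<mu>) (- (c * \<delta> * \<epsilon>) / y)
    = (\<Sum>n\<le>N + j. (-1) ^ cg_phase n (N + j - n) j * (\<epsilon> / 2) ^ n
        * sqrt (mu_fact (N + j - n) \<nu> * hahn_rho j \<nu> \<mu> (N + j)
            / (mu_fact n \<mu> * mu_fact (N + j) \<nu> * hahn_nu0 \<nu> \<mu> (N + j)))
        * dual_hahn n (hahn_z j \<nu> \<mu> (N + j)) \<nu> \<mu> (N + j)
        * chihara n x \<mu> (c * \<delta>) * chihara (N + j - n) y \<nu> (x * \<epsilon>))"
proof -
  define f where "f = (\<lambda>n. monic_chihara n x \<mu> (c * \<delta>))"
  define g where "g = (\<lambda>n. monic_chihara n y \<nu> (x * \<epsilon>))"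
  \<comment> \<open>\<open>B\<close> collects what is independent of \<open>n\<close>; its factor
    \<open>mu_fact j \<nu>\<close> undoes the starting value in \<open>raised_left\<close>.\<close>
  define B where "B = (-1) ^ (j * (j + 1) div 2) * sqrt norm_const / sqrt (mu_fact N \<kappa>) * mu_fact j \<nu>"
  define M where "M = N + j"
  have pos: "mu_fact k \<mu> > 0" "mu_fact k \<nu> > 0" "mu_fact k \<kappa> > 0" for k
    using mu_pos nu_pos kappa_pos by (auto intro: mu_fact_pos)
  have summand: "(-1) ^ cg_phase n (M - n) j * (\<epsilon> / 2) ^ n
        * sqrt (mu_fact (M - n) \<nu> * hahn_rho j \<nu> \<mu> M / (mu_fact n \<mu> * mu_fact M \<nu> * hahn_nu0 \<nu> \<mu> M))
        * dual_hahn n (hahn_z j \<nu> \<mu> M) \<nu> \<mu> M * chihara n x \<mu> (c * \<delta>) * chihara (M - n) y \<nu> (x * \<epsilon>)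
      = B * (raised N n (M - n) * f n * g (M - n))" if n: "n \<le> M" for n
  proof -
    have phase: "(-1 :: real) ^ cg_phase n (M - n) j = (-1) ^ (j * (j + 1) div 2) * hahn_sign M n"
      using n by (simp add: cg_phase_def hahn_sign_def power_add mult_ac)
    have r: "raised N n (M - n) = 1 / mu_fact j \<nu> * hahn_sign M n * (\<epsilon> / 2) ^ n
        * dual_hahn n (hahn_z j \<nu> \<mu> M) \<nu> \<mu> M / mu_fact n \<mu>"
      using raised_eq_dual_hahn[of n "M - n" N] n by (simp add: M_def raised_left)
    \<comment> \<open>The root is written as a quotient so that \<open>mu_fact n \<mu>\<close>
      cancels against the denominator of \<open>raised\<close> and the reciprocal root in
      \<open>sqrt_rho_nu\<close> appears.\<close>
    have q: "f n = mu_fact n \<mu> / sqrt (mu_fact n \<mu>) * chihara n x \<mu> (c * \<delta>)"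
      using pos(1)[of n] by (simp add: f_def monic_chihara_def real_div_sqrt)
    show ?thesis
      unfolding sqrt_rho_nu[OF n[unfolded M_def], folded M_def] phase r q g_def monic_chihara_def B_def
      using pos by (simp add: less_imp_neq[symmetric])
  qed
  have "(\<Sum>n\<le>M. (-1) ^ cg_phase n (M - n) j * (\<epsilon> / 2) ^ n
        * sqrt (mu_fact (M - n) \<nu> * hahn_rho j \<nu> \<mu> M / (mu_fact n \<mu> * mu_fact M \<nu> * hahn_nu0 \<nu> \<mu> M))
        * dual_hahn n (hahn_z j \<nu> \<mu> M) \<nu> \<mu> M * chihara n x \<mu> (c * \<delta>) * chihara (M - n) y \<nu> (x * \<epsilon>))
    = B * pairing f g M (raised N)"
    unfolding pairing_def sum_distrib_left by (intro sum.cong refl summand) simp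
  also have "\<dots> = B * (sqrt (mu_fact N \<kappa>) * chihara N y \<kappa> (c * (\<delta> * \<epsilon> * (-1) ^ j)) * pairing f g j (lowest \<mu> \<nu> \<epsilon> j))"
    unfolding M_def f_def g_def pairing_raised by (simp add: monic_chihara_def)
  also have "\<dots> = chihara N y \<kappa> (c * (\<delta> * \<epsilon> * (-1) ^ j))
      * ((-1) ^ (j * (j + 1) div 2) * sqrt norm_const * mu_fact j \<nu> * pairing f g j (lowest \<mu> \<nu> \<epsilon> j))"
    using pos(3)[of N] by (simp add: B_def)
  also have "\<dots> = chihara N y \<kappa> (c * (\<delta> * \<epsilon> * (-1) ^ j)) * (sgn y ^ j * jacobi_K j (\<delta> * \<epsilon>) y \<nu> \<mu> c
      * big_jacobi j (\<epsilon> * x / y) (2 * \<nu>) (2 * \<mu>) (- (c * \<delta> * \<epsilon>) / y))"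
    unfolding jacobi_K_times_big_jacobi[OF assms] f_def g_def ..
  finally show ?thesis
    unfolding M_def by (simp only: mult_ac)
qed

end

theorem proposition4p4:
  fixes \<mu>1 \<mu>2 \<epsilon>1 \<epsilon>2 c \<mu>12 \<epsilon>12 lam1 lam2 :: real and N j :: nat
  assumes "\<mu>1 > 0" and "\<mu>2 > 0"
    and "\<epsilon>1 \<in> {1, -1}" and "\<epsilon>2 \<in> {1, -1}"
    and "\<mu>12 = \<mu>1 + \<mu>2 + real j + 1/2"
    and "\<epsilon>12 = \<epsilon>1 * \<epsilon>2 * (-1) ^ j"
    and "\<bar>lam2\<bar> > \<bar>lam1\<bar>" and "\<bar>lam1\<bar> > \<bar>c\<bar>"
  shows "sgn lam2 ^ j * jacobi_K j (\<epsilon>1 * \<epsilon>2) lam2 \<mu>2 \<mu>1 c * chihara N lam2 \<mu>12 (c * \<epsilon>12)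
      * big_jacobi j (\<epsilon>2 * lam1 / lam2) (2 * \<mu>2) (2 * \<mu>1) (- (c * \<epsilon>1 * \<epsilon>2) / lam2)
    = (\<Sum>(n1, n2) \<in> {(n1, n2). n1 + n2 = N + j}.
        (-1) ^ cg_phase n1 n2 j * (\<epsilon>2 / 2) ^ n1
        * sqrt (mu_fact n2 \<mu>2 * hahn_rho j \<mu>2 \<mu>1 (n1 + n2)
            / (mu_fact n1 \<mu>1 * mu_fact (n1 + n2) \<mu>2 * hahn_nu0 \<mu>2 \<mu>1 (n1 + n2)))
        * dual_hahn n1 (hahn_z j \<mu>2 \<mu>1 (n1 + n2)) \<mu>2 \<mu>1 (n1 + n2)
        * chihara n1 lam1 \<mu>1 (c * \<epsilon>1)
        * chihara n2 lam2 \<mu>2 (lam1 * \<epsilon>2))"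
proof -
  interpret tensor_product \<mu>1 \<mu>2 \<epsilon>2 j
    by unfold_locales (use assms in auto)
  have kappa: "\<mu>12 = \<kappa>"
    by (simp add: assms(5) \<kappa>_def)
  have lam: "\<bar>lam2\<bar> > \<bar>c\<bar>"
    using assms(7,8) by simp
  show ?thesis
    unfolding kappa assms(6) addition_formula[OF assms(3) lam]
    by (rule sum.reindex_bij_witness[of _ fst "\<lambda>n. (n, N + j - n)"]) auto
qed

end
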